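(* Suppose that $g$ is holomorphic on $D$, continuous on $\overline{D}$, and vanishes nowhere on $\mathbb{T}$. Let $z_1,z_2,\ldots,z_n\in\mathbb{T}$ be distinct and let $\beta_1,\beta_2,\ldots,\beta_n$ be real numbers greater than $-2$. Let $f(z)=c\,g(z)\prod_{i=1}^n(1-z\overline{z_i})^{\beta_i}$, where the constant $c>0$ is chosen so that $\|f\|=1$. Then $f$ is strongly exposed in the unit ball of $A^1$ if and only if all the functions $f_{\beta_i}(z)=c_{\beta_i}(1-z)^{\beta_i}$, $i=1,\dots,n$, are strongly exposed in the unit ball of $A^1$. In particular, if all $\beta_i>-1$, then $f$ is strongly exposed; and every polynomial $p$ with $\|p\|=1$ is strongly exposed in the unit ball of $A^1$.
   Context: $D$ is the open unit disc in $\mathbb{C}$, $\mathbb{T}=\partial D$, and $dA=\frac1\pi r\,dr\,d\theta$ is normalized Lebesgue measure on $D$. The Bergman space $A^1$ is the Banach space of holomorphic functions $f$ on $D$ with $\|f\|=\int_D|f|\,dA<\infty$. Powers $(1-\zeta)^\beta$ for $\zeta\in D$ are defined by the principal branch. For real $\beta>-2$, $c_\beta>0$ is the constant such that $f_\beta(z)=c_\beta(1-z)^\beta$ has $\|f_\beta\|=1$. For a Banach space $X$, a point $x\in X$ with $\|x\|=1$ is called strongly exposed (in the unit ball of $X$) if there is $L\in X^*$ with $L(x)=\|L\|=1$ such that for every sequence $(x_n)$ in the unit ball of $X$ with $\lim_{n\to\infty} L(x_n)=1$ one has $\|x_n-x\|\to0$. *)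

theory Defs
  imports "HOL-Complex_Analysis.Complex_Analysis"
begin

text \<open>
  A complex normed space is given here by a set \<open>X\<close> of complex-valued functions together with
  a norm \<open>N\<close>. It is harmless if \<open>N\<close> is only a seminorm because functions on a subset are
  represented by total functions: a functional that is bounded with respect to \<open>N\<close> cannot
  distinguish \<open>f\<close> and \<open>g\<close> if \<open>N (f - g) = 0\<close>.
\<close>

definition in_dual ::
  "('a \<Rightarrow> complex) set \<Rightarrow> (('a \<Rightarrow> complex) \<Rightarrow> real) \<Rightarrow> (('a \<Rightarrow> complex) \<Rightarrow> complex) \<Rightarrow> bool" where
  "in_dual X N L \<longleftrightarrow>
     (\<forall>f\<in>X. \<forall>g\<in>X. L (\<lambda>z. f z + g z) = L f + L g) \<and>
     (\<forall>a. \<forall>f\<in>X. L (\<lambda>z. a * f z) = a * L f) \<and>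
     (\<exists>B. \<forall>f\<in>X. norm (L f) \<le> B * N f)"

definition dual_norm ::
  "('a \<Rightarrow> complex) set \<Rightarrow> (('a \<Rightarrow> complex) \<Rightarrow> real) \<Rightarrow> (('a \<Rightarrow> complex) \<Rightarrow> complex) \<Rightarrow> real" where
  "dual_norm X N L = (SUP f\<in>{f\<in>X. N f \<le> 1}. norm (L f))"

definition strongly_exposed ::
  "('a \<Rightarrow> complex) set \<Rightarrow> (('a \<Rightarrow> complex) \<Rightarrow> real) \<Rightarrow> ('a \<Rightarrow> complex) \<Rightarrow> bool" where
  "strongly_exposed X N f \<longleftrightarrow>
     f \<in> X \<and> N f = 1 \<and>
     (\<exists>L. in_dual X N L \<and> L f = 1 \<and> dual_norm X N L = 1 \<and>
        (\<forall>x :: nat \<Rightarrow> 'a \<Rightarrow> complex.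
           (\<forall>k. x k \<in> X \<and> N (x k) \<le> 1) \<longrightarrow> (\<lambda>k. L (x k)) \<longlonglongrightarrow> 1 \<longrightarrow>
           (\<lambda>k. N (\<lambda>z. x k z - f z)) \<longlonglongrightarrow> 0))"

text \<open>
  The values of a function outside the unit disc are irrelevant. The factor \<open>1 / pi\<close> normalizes
  the area measure of the disc to 1.
\<close>

definition bergman1 :: "(complex \<Rightarrow> complex) set" where
  "bergman1 = {f. f holomorphic_on ball 0 1 \<and> set_integrable lborel (ball 0 1) f}"

definition bergman1_norm :: "(complex \<Rightarrow> complex) \<Rightarrow> real" where
  "bergman1_norm f = (1 / pi) * (LINT z:ball 0 1|lborel. norm (f z))"

abbreviation strongly_exposed_bergman1 :: "(complex \<Rightarrow> complex) \<Rightarrow> bool" where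
  "strongly_exposed_bergman1 \<equiv> strongly_exposed bergman1 bergman1_norm"

text \<open>Well-defined for \<open>\<beta> > -2\<close>, where \<open>(1 - z) powr \<beta>\<close> has finite nonzero norm.\<close>

definition c_const :: "real \<Rightarrow> real" where
  "c_const \<beta> =
     (THE c. c > 0 \<and> bergman1_norm (\<lambda>z. of_real c * (1 - z) powr of_real \<beta>) = 1)"

definition f_power :: "real \<Rightarrow> complex \<Rightarrow> complex" where
  "f_power \<beta> = (\<lambda>z. of_real (c_const \<beta>) * (1 - z) powr of_real \<beta>)"

end

(* If the unit ball sequence (x_n) satisfies L x_n -> 1 for L k = (1/pi) int (cnj (sgn f)) k, pass to a locally uniform limit
   h and let d_n = x_n - h. The norms of h and d_n asymptotically add up to at most 1, so f is strongly exposed as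
   soon as |L d_n| is asymptotically at most q |d_n| for some q < 1. This holds if cnj (sgn f) is within q < 1, in the sup
   norm, of a symbol that is compact on A^1, i.e. whose pairing with d_n tends to 0.

   Continuous symbols are compact. Near a point a of the circle with exponent b, cnj (sgn f) is a constant times
   exp(-i b theta) up to an error that is continuous, with theta the argument of 1 - z cnj a. Polar coordinates centred
   at a show that the symbol exp(-i b theta) - l exp(2 i theta) is compact when its integral against exp(-2 i theta) over
   (-pi/2, pi/2) vanishes, that is for l = sin(s) / s with s = (b + 2) pi / 2. What is left of cnj (sgn f) has modulus
   |l| < 1 as b > -2. So every f of the given form is strongly exposed, in particular every f_b with b > -2, and both sides
   of the equivalence hold. *)

theory Submission
  imports Defs "HOL-Real_Asymp.Real_Asymp" "HOL-Computational_Algebra.Fundamental_Theorem_Algebra"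
begin

section \<open>Area measure in the plane\<close>

text \<open>The vanishing condition on the symbol comes from counting. Coefficients of a function in
  the unit ball of \<open>A^1\<close> grow at most linearly, so a bounded symbol is compact once its
  moments against z^m are summable with weight m + 1. Integrating x z^m along the ray 1 - z = x (1 +
  i t) out to the circle yields two terms from the exit point and one from the point 1 itself; the
  last is (1 + i t)^(-2) / ((m + 1) (m + 2)). With t = tan theta, (1 + i t)^(-2) dt is exp(-2 i
  theta) dtheta, which explains the test function. For exp(-i b theta) the exit terms, once
  integrated over theta, nearly cancel and leave order m^(-3). So the integral against exp(-2 i
  theta) is the only coefficient of order m^(-2), the borderline where the weighted sum diverges
  logarithmically. The correction l exp(2 i theta) is the cheapest one: a function of theta with the
  same integral has sup norm at least |l|. With several singular points the remainders must not add
  up, so each is cut off near its own point; the cutoff costs only a continuous symbol.\<close>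

lemma borel_measurable_Complex [measurable (raw)]:
  assumes "f \<in> borel_measurable M" "g \<in> borel_measurable M"
  shows "(\<lambda>x. Complex (f x) (g x)) \<in> borel_measurable M"
  unfolding Complex_eq using assms by measurable

text \<open>Lebesgue measure is determined by its values on boxes, and a complex box pulls back to a
  rectangle. This opens the way to Fubini in real and imaginary part.\<close>

lemma distr_Complex: "distr (lborel \<Otimes>\<^sub>M lborel) borel (\<lambda>p. Complex (fst p) (snd p)) = lborel"
proof (rule lborel_eqI[symmetric])
  show "sets (distr (lborel \<Otimes>\<^sub>M lborel) borel (\<lambda>p. Complex (fst p) (snd p))) = sets borel"
    by simp
  fix l u :: complex
  assume le: "\<And>b. b \<in> Basis \<Longrightarrow> l \<bullet> b \<le> u \<bullet> b"
  have "(\<lambda>p. Complex (fst p) (snd p)) -` box l u = {Re l<..<Re u} \<times> {Im l<..<Im u}"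
    by (auto simp: mem_box Basis_complex_def)
  then have "emeasure (distr (lborel \<Otimes>\<^sub>M lborel) borel (\<lambda>p. Complex (fst p) (snd p))) (box l u)
      = emeasure (lborel \<Otimes>\<^sub>M lborel) ({Re l<..<Re u} \<times> {Im l<..<Im u})"
    by (subst emeasure_distr) (auto simp: space_pair_measure)
  also have "\<dots> = ennreal (\<Prod>b\<in>Basis. (u - l) \<bullet> b)"
    using le[of 1] le[of \<i>]
    by (simp add: lborel.emeasure_pair_measure_Times Basis_complex_def ennreal_mult)
  finally show "emeasure (distr (lborel \<Otimes>\<^sub>M lborel) borel (\<lambda>p. Complex (fst p) (snd p))) (box l u)
      = ennreal (\<Prod>b\<in>Basis. (u - l) \<bullet> b)" .
qed

lemma nn_integral_complex_iterated:
  fixes F :: "complex \<Rightarrow> ennreal"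
  assumes [measurable]: "F \<in> borel_measurable borel"
  shows "(\<integral>\<^sup>+z. F z \<partial>lborel) = (\<integral>\<^sup>+x. \<integral>\<^sup>+y. F (Complex x y) \<partial>lborel \<partial>lborel)"
proof -
  have "(\<integral>\<^sup>+z. F z \<partial>lborel) = (\<integral>\<^sup>+p. F (Complex (fst p) (snd p)) \<partial>(lborel \<Otimes>\<^sub>M lborel))"
    by (subst distr_Complex[symmetric]) (simp add: nn_integral_distr)
  also have "\<dots> = (\<integral>\<^sup>+x. \<integral>\<^sup>+y. F (Complex x y) \<partial>lborel \<partial>lborel)"
    by (subst lborel.nn_integral_fst[symmetric]) simp_all
  finally show ?thesis .
qed

lemma nn_integral_complex_iterated':
  fixes F :: "complex \<Rightarrow> ennreal"
  assumes [measurable]: "F \<in> borel_measurable borel"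
  shows "(\<integral>\<^sup>+z. F z \<partial>lborel) = (\<integral>\<^sup>+y. \<integral>\<^sup>+x. F (Complex x y) \<partial>lborel \<partial>lborel)"
  using nn_integral_complex_iterated[OF assms]
    lborel_pair.Fubini'[of "\<lambda>x y. F (Complex x y)"] by simp

section \<open>Invariance of area under shears and rotations\<close>

lemma nn_integral_translate_real:
  fixes f :: "real \<Rightarrow> ennreal"
  assumes [measurable]: "f \<in> borel_measurable borel"
  shows "(\<integral>\<^sup>+x. f (t + x) \<partial>lborel) = (\<integral>\<^sup>+x. f x \<partial>lborel)"
  using nn_integral_real_affine[OF assms, of 1 t] by simp

text \<open>On each horizontal line the shear is a translation, so Fubini with the imaginary part
  outermost reduces it to one dimension.\<close>

lemma nn_integral_shear_Re:
  fixes F :: "complex \<Rightarrow> ennreal"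
  assumes [measurable]: "F \<in> borel_measurable borel"
  shows "(\<integral>\<^sup>+z. F (z + of_real (a * Im z)) \<partial>lborel) = (\<integral>\<^sup>+z. F z \<partial>lborel)"
proof -
  have *: "Complex x y + complex_of_real (a * y) = Complex (a * y + x) y" for x y
    by (simp add: complex_eq_iff)
  show ?thesis
    by (subst (1 2) nn_integral_complex_iterated')
      (simp_all add: * nn_integral_translate_real[of "\<lambda>x. F (Complex x _)"] del: of_real_mult)
qed

lemma nn_integral_shear_Im:
  fixes F :: "complex \<Rightarrow> ennreal"
  assumes [measurable]: "F \<in> borel_measurable borel"
  shows "(\<integral>\<^sup>+z. F (z + \<i> * of_real (b * Re z)) \<partial>lborel) = (\<integral>\<^sup>+z. F z \<partial>lborel)"
proof -
  have *: "Complex x y + \<i> * complex_of_real (b * x) = Complex x (b * x + y)" for x y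
    by (simp add: complex_eq_iff)
  show ?thesis
    by (subst (1 2) nn_integral_complex_iterated)
      (simp_all add: * nn_integral_translate_real[of "\<lambda>y. F (Complex _ y)"] del: of_real_mult)
qed

text \<open>A rotation by phi is a product of three shears: horizontal with factor -tan(phi/2),
  vertical with factor sin phi, horizontal again. Here \<open>a\<close> is -tan(phi/2) in the form
  -(1 - cos phi) / sin phi, hence the condition on \<open>Im u\<close>.\<close>

lemma nn_integral_rotate_aux:
  fixes F :: "complex \<Rightarrow> ennreal"
  assumes [measurable]: "F \<in> borel_measurable borel" and u: "norm u = 1" "Im u \<noteq> 0"
  shows "(\<integral>\<^sup>+z. F (u * z) \<partial>lborel) = (\<integral>\<^sup>+z. F z \<partial>lborel)"
proof -
  define a where "a = - (1 - Re u) / Im u"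
  define S where "S = (\<lambda>z. z + complex_of_real (a * Im z))"
  define T where "T = (\<lambda>z. z + \<i> * complex_of_real (Im u * Re z))"
  have [measurable]: "S \<in> borel_measurable borel" "T \<in> borel_measurable borel"
    unfolding S_def T_def by (auto intro!: borel_measurable_continuous_onI continuous_intros)
  have sq: "(Re u)\<^sup>2 + (Im u)\<^sup>2 = 1" using u(1) by (simp add: cmod_def)
  have 0: "a * Im u = Re u - 1" using u(2) by (simp add: a_def)
  have aa: "a * Re u + a = - Im u"
  proof -
    have "Im u * (a * Re u + a) = Im u * (- Im u)"
    proof -
      have "Im u * (a * Re u + a) = (a * Im u) * (Re u + 1)" by (simp add: algebra_simps)
      also have "\<dots> = (Re u)\<^sup>2 - 1" unfolding 0 by (simp add: algebra_simps power2_eq_square)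
      also have "\<dots> = Im u * (- Im u)" using sq by (simp add: power2_eq_square)
      finally show ?thesis .
    qed
    then show ?thesis using u(2) by (metis mult_left_cancel)
  qed
  have ReS: "Re (S z) = Re z + a * Im z" and ImS: "Im (S z) = Im z" for z
    by (simp_all add: S_def)
  have uz: "u * z = S (T (S z))" for z
  proof -
    obtain x y where z: "z = Complex x y" by (cases z)
    have "Im (T (S z)) = y + Im u * (x + a * y)" by (simp add: z S_def T_def)
    also have "\<dots> = y + Im u * x + (a * Im u) * y" by (simp add: algebra_simps)
    also have "\<dots> = Im u * x + Re u * y" unfolding 0 by (simp add: algebra_simps)
    finally have i: "Im (T (S z)) = Im u * x + Re u * y" .
    have "Re (S (T (S z))) = x + a * y + a * (Im u * x + Re u * y)"
      using i by (simp add: ReS) (simp add: T_def S_def z)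
    also have "\<dots> = x + (a * Im u) * x + (a * Re u + a) * y" by (simp add: algebra_simps)
    also have "\<dots> = Re u * x - Im u * y" unfolding 0 aa by (simp add: algebra_simps)
    finally have "Re (S (T (S z))) = Re u * x - Im u * y" .
    moreover have "Im (S (T (S z))) = Im u * x + Re u * y"
      using i by (simp add: ImS)
    ultimately show ?thesis by (simp add: complex_eq_iff z algebra_simps)
  qed
  have "(\<integral>\<^sup>+z. F (S (T (S z))) \<partial>lborel) = (\<integral>\<^sup>+z. F (S (T z)) \<partial>lborel)"
    using nn_integral_shear_Re[of "\<lambda>z. F (S (T z))" a] by (simp add: S_def)
  also have "\<dots> = (\<integral>\<^sup>+z. F (S z) \<partial>lborel)"
    using nn_integral_shear_Im[of "\<lambda>z. F (S z)" "Im u"] by (simp add: T_def)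
  also have "\<dots> = (\<integral>\<^sup>+z. F z \<partial>lborel)"
    using nn_integral_shear_Re[of F a] by (simp add: S_def)
  finally show ?thesis by (simp add: uz)
qed

lemma nn_integral_rotate:
  fixes F :: "complex \<Rightarrow> ennreal"
  assumes [measurable]: "F \<in> borel_measurable borel" and u: "norm u = 1"
  shows "(\<integral>\<^sup>+z. F (u * z) \<partial>lborel) = (\<integral>\<^sup>+z. F z \<partial>lborel)"
proof (cases "Im u = 0")
  case False
  then show ?thesis using nn_integral_rotate_aux assms by blast
next
  case True
  \<comment> \<open>Now \<open>u\<close> is 1 or -1. It is split as \<open>u / \<i>\<close> times
    \<open>\<i>\<close>, two rotations with nonzero imaginary part.\<close>
  have nu: "norm (u / \<i>) = 1" "Im (u / \<i>) \<noteq> 0"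
    using u True by (auto simp: norm_divide cmod_def)
  have "(\<integral>\<^sup>+z. F (u / \<i> * (\<i> * z)) \<partial>lborel) = (\<integral>\<^sup>+z. F (u / \<i> * z) \<partial>lborel)"
    by (rule nn_integral_rotate_aux[of "\<lambda>z. F (u / \<i> * z)"]) auto
  also have "\<dots> = (\<integral>\<^sup>+z. F z \<partial>lborel)"
    by (rule nn_integral_rotate_aux) (use nu in auto)
  finally show ?thesis by (simp add: mult.assoc[symmetric] del: divide_i)
qed

lemma lborel_distr_rotate:
  assumes u: "norm u = 1"
  shows "distr lborel borel (\<lambda>z. u * z) = (lborel :: complex measure)"
proof (rule measure_eqI)
  fix A assume "A \<in> sets (distr lborel borel (\<lambda>z. u * z))"
  then have [measurable]: "A \<in> sets borel" by simp
  have "emeasure (distr lborel borel (\<lambda>z. u * z)) A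
      = (\<integral>\<^sup>+z. indicator A z \<partial>distr lborel borel (\<lambda>z. u * z))"
    by simp
  also have "\<dots> = (\<integral>\<^sup>+z. indicator A (u * z) \<partial>lborel)"
    by (subst nn_integral_distr) auto
  also have "\<dots> = emeasure lborel A"
    by (subst nn_integral_rotate) (use u in auto)
  finally show "emeasure (distr lborel borel (\<lambda>z. u * z)) A = emeasure lborel A" .
qed simp

text \<open>For each fixed real part x other than 0, y = x t is a one-dimensional scaling with
  factor |x|, so Fubini gives the Jacobian. The slope t takes the place of the polar angle.\<close>

lemma distr_slope_coordinates:
  "distr (density (lborel \<Otimes>\<^sub>M lborel) (\<lambda>p. ennreal \<bar>fst p\<bar>)) borel
     (\<lambda>p. Complex (fst p) (fst p * snd p)) = lborel"
proof (rule measure_eqI)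
  let ?M = "distr (density (lborel \<Otimes>\<^sub>M lborel) (\<lambda>p. ennreal \<bar>fst p\<bar>)) borel
     (\<lambda>p. Complex (fst p) (fst p * snd p))"
  fix A assume "A \<in> sets ?M"
  then have [measurable]: "A \<in> sets borel" by simp
  have "emeasure ?M A = (\<integral>\<^sup>+z. indicator A z \<partial>?M)"
    by simp
  also have "\<dots> = (\<integral>\<^sup>+p. ennreal \<bar>fst p\<bar> * indicator A (Complex (fst p) (fst p * snd p)) \<partial>(lborel \<Otimes>\<^sub>M lborel))"
    by (subst nn_integral_distr) (auto simp: nn_integral_density)
  also have "\<dots> = (\<integral>\<^sup>+x. \<integral>\<^sup>+t. ennreal \<bar>x\<bar> * indicator A (Complex x (x * t)) \<partial>lborel \<partial>lborel)"
    by (subst lborel.nn_integral_fst[symmetric]) simp_all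
  also have "\<dots> = (\<integral>\<^sup>+x. \<integral>\<^sup>+y. indicator A (Complex x y) \<partial>lborel \<partial>lborel)"
  proof (rule nn_integral_cong_AE)
    have "AE x in lborel. x \<noteq> (0::real)" by (rule AE_lborel_singleton)
    then show "AE x in lborel. (\<integral>\<^sup>+t. ennreal \<bar>x\<bar> * indicator A (Complex x (x * t)) \<partial>lborel)
        = (\<integral>\<^sup>+y. indicator A (Complex x y) \<partial>lborel)"
    proof eventually_elim
      case (elim x)
      then show ?case
        by (subst nn_integral_real_affine[where c = x and t = 0]) (auto simp: nn_integral_cmult)
    qed
  qed
  also have "\<dots> = emeasure lborel A"
    by (subst nn_integral_complex_iterated[symmetric]) simp_all
  finally show "emeasure ?M A = emeasure lborel A" .
qed simp

text \<open>Along the ray \<open>w = x (1 + i t)\<close> the argument of \<open>w\<close> is \<open>arctan t\<close>.\<close>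

lemma integral_slope_coordinates:
  fixes F :: "complex \<Rightarrow> complex"
  assumes F: "integrable lborel F"
  shows "(LINT z|lborel. F z)
     = (LINT t|lborel. LINT x|lborel. \<bar>x\<bar> *\<^sub>R F (Complex x (x * t)))"
proof -
  have [measurable]: "F \<in> borel_measurable borel" using F by auto
  let ?D = "density (lborel \<Otimes>\<^sub>M lborel) (\<lambda>p::real\<times>real. ennreal \<bar>fst p\<bar>)"
  have "integrable (distr ?D borel (\<lambda>p. Complex (fst p) (fst p * snd p))) F"
    unfolding distr_slope_coordinates by (rule F)
  then have "integrable ?D (\<lambda>p. F (Complex (fst p) (fst p * snd p)))"
    by (subst (asm) integrable_distr_eq) auto
  then have i: "integrable (lborel \<Otimes>\<^sub>M lborel)
      (\<lambda>p. \<bar>fst p\<bar> *\<^sub>R F (Complex (fst p) (fst p * snd p)))"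
    by (subst (asm) integrable_density) auto
  have "(LINT z|lborel. F z) = (LINT p|?D. F (Complex (fst p) (fst p * snd p)))"
    by (subst distr_slope_coordinates[symmetric], subst integral_distr) auto
  also have "\<dots> = (LINT p|(lborel \<Otimes>\<^sub>M lborel). \<bar>fst p\<bar> *\<^sub>R F (Complex (fst p) (fst p * snd p)))"
    by (subst integral_density) auto
  also have "\<dots> = (LINT t|lborel. LINT x|lborel. \<bar>x\<bar> *\<^sub>R F (Complex x (x * t)))"
    using lborel_pair.integral_snd[of "\<lambda>x t. \<bar>x\<bar> *\<^sub>R F (Complex x (x * t))"] i
    by (simp add: case_prod_beta')
  finally show ?thesis .
qed

section \<open>Taylor coefficients in the Bergman space\<close>

text \<open>Not normalised: the total mass is \<open>pi\<close>, so \<open>bergman1_norm\<close> is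
  the L1 norm for this measure divided by \<open>pi\<close>. Restricting the space makes behaviour
  outside the ball irrelevant for measurability too.\<close>

definition disc :: "complex measure" where
  "disc = restrict_space lborel (ball 0 1)"

lemma space_disc [simp]: "space disc = ball 0 1"
  by (simp add: disc_def space_restrict_space)

lemma sets_disc: "sets disc = sets (restrict_space borel (ball 0 1))"
  by (auto simp: disc_def sets_restrict_space)

lemma in_sets_disc: "A \<in> sets borel \<Longrightarrow> A \<subseteq> ball 0 1 \<Longrightarrow> A \<in> sets disc"
  by (auto simp: disc_def sets_restrict_space)

lemma measure_disc_ball: "0 \<le> r \<Longrightarrow> r \<le> 1 \<Longrightarrow> measure disc (ball 0 r) = pi * r\<^sup>2"
  by (simp add: disc_def measure_restrict_space content_ball unit_ball_vol_2 subset_ball)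

interpretation disc: finite_measure disc
proof (rule finite_measureI)
  have "emeasure disc (space disc) = emeasure lborel (ball (0::complex) 1)"
    by (simp add: disc_def emeasure_restrict_space space_restrict_space)
  then show "emeasure disc (space disc) \<noteq> \<infinity>"
    using emeasure_bounded_finite[of "ball (0::complex) 1"] by simp
qed

lemma integrable_disc: "integrable disc f \<longleftrightarrow> set_integrable lborel (ball 0 1) f"
  for f :: "complex \<Rightarrow> 'b::{banach, second_countable_topology}"
  by (simp add: disc_def set_integrable_def integrable_restrict_space)

lemma integral_disc: "(LINT z|disc. f z) = (LINT z:ball 0 1|lborel. f z)"
  for f :: "complex \<Rightarrow> 'b::{banach, second_countable_topology}"
  by (simp add: disc_def set_lebesgue_integral_def integral_restrict_space)

lemma borel_measurable_disc_iff: "f \<in> borel_measurable disc \<longleftrightarrow>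
    (\<lambda>z. indicator (ball 0 1) z *\<^sub>R f z) \<in> borel_measurable borel"
  for f :: "complex \<Rightarrow> 'b::real_normed_vector"
  by (simp add: disc_def borel_measurable_restrict_space_iff)

lemma borel_measurable_disc:
  "f \<in> borel_measurable borel \<Longrightarrow> f \<in> borel_measurable disc"
  unfolding disc_def by (intro measurable_restrict_space1) simp

lemma continuous_on_imp_measurable_disc:
  fixes f :: "complex \<Rightarrow> 'b::topological_space"
  assumes "continuous_on (ball 0 1) f"
  shows "f \<in> borel_measurable disc"
  using borel_measurable_continuous_on_restrict[OF assms]
  by (simp add: measurable_cong_sets[OF sets_disc refl])

lemma integrable_disc_bounded:
  fixes f :: "complex \<Rightarrow> 'b::{banach, second_countable_topology}"
  assumes "f \<in> borel_measurable disc" "\<And>z. z \<in> ball 0 1 \<Longrightarrow> norm (f z) \<le> B"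
  shows "integrable disc f"
  using assms by (intro disc.integrable_const_bound[of _ B]) auto

lemma integral_disc_rotate:
  fixes f :: "complex \<Rightarrow> 'b::{banach, second_countable_topology}"
  assumes f: "f \<in> borel_measurable disc" and u: "norm u = 1"
  shows "(LINT z|disc. f (u * z)) = (LINT z|disc. f z)"
    and "(\<lambda>z. f (u * z)) \<in> borel_measurable disc"
proof -
  let ?F = "\<lambda>z. indicator (ball 0 1) z *\<^sub>R f z"
  have [measurable]: "?F \<in> borel_measurable borel"
    using f by (simp add: borel_measurable_disc_iff)
  have eq: "indicator (ball 0 1) z *\<^sub>R f (u * z) = ?F (u * z)" for z
    using u by (auto simp: indicator_def norm_mult)
  have "(LINT z|lborel. ?F z) = (LINT z|lborel. ?F (u * z))"
    by (subst lborel_distr_rotate[OF u, symmetric], subst integral_distr) auto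
  then show "(LINT z|disc. f (u * z)) = (LINT z|disc. f z)"
    by (simp add: integral_disc set_lebesgue_integral_def eq)
  show "(\<lambda>z. f (u * z)) \<in> borel_measurable disc"
    unfolding borel_measurable_disc_iff eq by measurable
qed

lemma integral_disc_dilate:
  fixes f :: "complex \<Rightarrow> 'b::{banach, second_countable_topology}"
  assumes f: "f \<in> borel_measurable disc" and r: "0 < r" "r \<le> 1"
  shows "(LINT z|disc. indicator (ball 0 r) z *\<^sub>R f z) = r\<^sup>2 *\<^sub>R (LINT z|disc. f (of_real r * z))"
proof -
  define F where "F = (\<lambda>z. indicator (ball 0 r) z *\<^sub>R (indicator (ball 0 1) z *\<^sub>R f z))"
  have [measurable]: "F \<in> borel_measurable borel"
    using f[unfolded borel_measurable_disc_iff] unfolding F_def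
    by (intro borel_measurable_scaleR[of "indicator (ball 0 r)"] borel_measurable_indicator) auto
  have eq: "indicator (ball 0 1) z *\<^sub>R f (of_real r * z) = F (0 + r *\<^sub>R z)" for z
  proof -
    have "norm z < 1 \<Longrightarrow> r * norm z < 1"
      using r by (smt (verit) mult_left_le_one_le norm_ge_zero)
    then show ?thesis using r by (auto simp: F_def indicator_def norm_mult scaleR_conv_of_real)
  qed
  have "(LINT z|lborel. F z) = (LINT z|density (distr lborel borel (\<lambda>x. 0 + r *\<^sub>R x))
      (\<lambda>_. ennreal (\<bar>r\<bar> ^ 2)). F z)"
    using lborel_affine[of r "0::complex"] r by simp
  also have "\<dots> = r\<^sup>2 *\<^sub>R (LINT z|lborel. F (0 + r *\<^sub>R z))"
    by (subst integral_density) (auto simp: integral_distr)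
  finally show ?thesis
    unfolding integral_disc set_lebesgue_integral_def eq by (simp add: F_def ac_simps)
qed

text \<open>Rotation by \<open>t\<close> with (a - b) t = pi changes the sign of the integrand but
  not the integral.\<close>

lemma integral_disc_monomial:
  assumes "a \<noteq> b"
  shows "(LINT z|disc. z ^ a * cnj z ^ b) = 0"
proof -
  define t where "t = pi / (real a - real b)"
  have ab: "real a - real b \<noteq> 0" using assms by simp
  have m: "(\<lambda>z. z ^ a * cnj z ^ b) \<in> borel_measurable disc"
    by (intro continuous_on_imp_measurable_disc continuous_intros)
  have "cis t ^ a * cnj (cis t) ^ b = cis (real a * t - real b * t)"
    by (simp only: cis_cnj Complex.DeMoivre cis_mult) (simp add: algebra_simps)
  also have "real a * t - real b * t = (real a - real b) * t"
    by (simp add: algebra_simps)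
  also have "\<dots> = pi"
    using ab by (simp add: t_def)
  finally have c: "cis t ^ a * cnj (cis t) ^ b = -1" by simp
  have "(LINT z|disc. z ^ a * cnj z ^ b) = (LINT z|disc. (cis t * z) ^ a * cnj (cis t * z) ^ b)"
    using integral_disc_rotate(1)[OF m, of "cis t"] by simp
  also have "\<dots> = (LINT z|disc. (cis t ^ a * cnj (cis t) ^ b) * (z ^ a * cnj z ^ b))"
    by (simp add: power_mult_distrib mult_ac)
  also have "\<dots> = - (LINT z|disc. z ^ a * cnj z ^ b)"
    by (simp only: c) simp
  finally show ?thesis by simp
qed

definition disc_moment :: "nat \<Rightarrow> real" where
  "disc_moment m = (LINT z|disc. norm z ^ (2 * m))"

text \<open>The exact value is pi / (m + 1), but the order of magnitude suffices. For |z| at least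
  \<open>r\<close>, Bernoulli's inequality gives |z|^(2m) at least 1/2, and the annulus outside
  radius \<open>r\<close> has area at least pi (1 - r) = pi / (4 (m + 1)).\<close>

lemma disc_moment_ge: "disc_moment m \<ge> pi / (8 * real (m + 1))"
proof -
  define r where "r = 1 - 1 / (4 * real (m + 1))"
  have r: "0 < r" "r < 1" by (auto simp: r_def field_simps)
  have "1 + real (2 * m) * (- (1 / (4 * real (m + 1)))) \<le> (1 + (- (1 / (4 * real (m + 1))))) ^ (2 * m)"
    by (rule Bernoulli_inequality) (auto simp: field_simps)
  moreover have "1 + real (2 * m) * (- (1 / (4 * real (m + 1)))) \<ge> 1/2"
    by (simp add: field_simps)
  ultimately have p: "r ^ (2 * m) \<ge> 1/2" unfolding r_def diff_conv_add_uminus by linarith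
  have A: "ball 0 1 - ball 0 r \<in> sets disc" "ball 0 r \<in> sets disc" "ball 0 1 \<in> sets disc"
    using r by (auto intro!: in_sets_disc)
  have "pi / (8 * real (m + 1)) = (1/2) * (pi * (1 - r))"
    by (simp add: r_def)
  also have "\<dots> \<le> (1/2) * (pi * (1 - r\<^sup>2))"
    using r by (simp add: power2_eq_square mult_left_le)
  also have "pi * (1 - r\<^sup>2) = measure disc (ball 0 1 - ball 0 r)"
    using r A by (subst disc.finite_measure_Diff) (auto simp: measure_disc_ball algebra_simps)
  also have "(1/2) * \<dots> = (LINT z|disc. 1/2 * indicator (ball 0 1 - ball 0 r) z)"
    using A by (simp add: Int_absorb2 Diff_subset)
  also have "\<dots> \<le> disc_moment m"
    unfolding disc_moment_def
  proof (rule integral_mono)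
    show "integrable disc (\<lambda>z. 1 / 2 * indicat_real (ball 0 1 - ball 0 r) z)"
      using A by (auto simp: disc.emeasure_finite less_top[symmetric])
    show "integrable disc (\<lambda>z. norm z ^ (2 * m))"
      by (intro integrable_disc_bounded[of _ 1] continuous_on_imp_measurable_disc continuous_intros)
        (auto simp: power_le_one)
    fix z :: complex assume "z \<in> space disc"
    then show "1 / 2 * indicat_real (ball 0 1 - ball 0 r) z \<le> norm z ^ (2 * m)"
      using p r power_mono[of r "norm z" "2 * m"] by (auto simp: indicator_def)
  qed
  finally show ?thesis .
qed

lemma disc_moment_eq: "(LINT z|disc. z ^ m * cnj z ^ m) = of_real (disc_moment m)"
proof -
  have "z ^ m * cnj z ^ m = complex_of_real (norm z ^ (2 * m))" for z
    by (metis complex_norm_square of_real_power power_mult power_mult_distrib)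
  then show ?thesis unfolding disc_moment_def by (simp only: integral_complex_of_real)
qed

section \<open>Taylor coefficients as pairings with monomials\<close>

definition taylor :: "(complex \<Rightarrow> complex) \<Rightarrow> nat \<Rightarrow> complex" where
  "taylor k m = (deriv ^^ m) k 0 / fact m"

lemma taylor_sums:
  "k holomorphic_on ball 0 1 \<Longrightarrow> z \<in> ball 0 1 \<Longrightarrow> (\<lambda>m. taylor k m * z ^ m) sums k z"
  using holomorphic_power_series[of k 0 1 z] by (simp add: taylor_def)

lemma taylor_abs_summable:
  fixes z :: complex
  assumes "k holomorphic_on ball 0 1" "z \<in> ball 0 1"
  shows "summable (\<lambda>m. norm (taylor k m) * norm z ^ m)"
proof -
  obtain r where r: "norm z < r" "r < 1" using assms(2) dense by (metis mem_ball_0)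
  then have "0 < r" by (smt (verit) norm_ge_zero)
  then have "summable (\<lambda>m. taylor k m * of_real r ^ m)"
    using taylor_sums[OF assms(1), of "of_real r"] r by (auto simp: sums_iff)
  from powser_insidea[OF this, of z] show ?thesis
    using r \<open>0 < r\<close> by (simp add: norm_mult norm_power)
qed

lemma dilation_in_ball: "0 < r \<Longrightarrow> r \<le> 1 \<Longrightarrow> z \<in> ball 0 1 \<Longrightarrow> complex_of_real r * z \<in> ball 0 1"
  using mult_le_one[of r "norm z"] by (auto simp: norm_mult) (smt (verit) mult_left_le_one_le norm_ge_zero)

lemma dilation_holomorphic:
  "k holomorphic_on ball 0 1 \<Longrightarrow> 0 < r \<Longrightarrow> r \<le> 1 \<Longrightarrow>
    (\<lambda>z. k (of_real r * z)) holomorphic_on ball 0 1"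
  by (rule holomorphic_on_compose_gen[where g = k and t = "ball 0 1", unfolded o_def])
    (auto intro!: holomorphic_intros dilation_in_ball[simplified])

lemma dilation_bounded:
  assumes "k holomorphic_on ball 0 1" "0 < r" "r < 1"
  obtains B where "\<And>z. z \<in> ball 0 1 \<Longrightarrow> norm (k (of_real r * z)) \<le> B"
proof -
  have "compact (k ` cball 0 r)"
    using assms by (intro compact_continuous_image holomorphic_on_imp_continuous_on
        holomorphic_on_subset[OF assms(1)]) auto
  then obtain B where "\<forall>w\<in>k ` cball 0 r. norm w \<le> B"
    using compact_imp_bounded bounded_iff by metis
  then have "\<And>z. z \<in> cball 0 r \<Longrightarrow> norm (k z) \<le> B" by blast
  then show ?thesis
    using assms by (intro that[of B]) (auto simp: norm_mult mult_left_le)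
qed

text \<open>The dilation makes the power series converge absolutely and uniformly on the whole disc,
  which licenses integration term by term. For \<open>k\<close> itself this may fail.\<close>

lemma dilation_pairing_sums:
  assumes k: "k holomorphic_on ball 0 1" and r: "0 < r" "r < 1"
    and u: "u \<in> borel_measurable disc" "\<And>z. z \<in> ball 0 1 \<Longrightarrow> norm (u z) \<le> B"
  shows "(\<lambda>m. taylor k m * of_real r ^ m * (LINT z|disc. z ^ m * u z))
           sums (LINT z|disc. k (of_real r * z) * u z)"
proof -
  define f where "f m z = taylor k m * of_real r ^ m * (z ^ m * u z)" for m z
  have B: "B \<ge> 0" using u(2)[of 0] norm_ge_zero[of "u 0"] by (simp del: norm_ge_zero)
  have S: "summable (\<lambda>m. norm (taylor k m) * r ^ m)"
    using taylor_abs_summable[OF k, of "complex_of_real r"] r by simp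
  have bd: "norm (f m z) \<le> norm (taylor k m) * r ^ m * B" if z: "z \<in> ball 0 1" for m z
  proof -
    have "norm (z ^ m * u z) \<le> 1 * B"
      unfolding norm_mult norm_power using z u(2)[OF z] B
      by (intro mult_mono power_le_one) auto
    then show ?thesis
      unfolding f_def norm_mult norm_power using r by (simp add: mult_left_mono norm_mult norm_power)
  qed
  have mf: "f m \<in> borel_measurable disc" for m
    unfolding f_def
    by (intro borel_measurable_times[OF borel_measurable_const] borel_measurable_times[OF _ u(1)]
        continuous_on_imp_measurable_disc continuous_intros)
  have i: "integrable disc (f m)" for m
    by (rule integrable_disc_bounded[OF mf bd])
  have "(\<lambda>m. integral\<^sup>L disc (f m)) sums (LINT z|disc. (\<Sum>m. f m z))"
  proof (rule sums_integral[OF i])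
    show "AE z in disc. summable (\<lambda>m. norm (f m z))"
      using bd by (intro AE_I2 summable_comparison_test'[OF summable_mult2[OF S, of B]]) auto
    show "summable (\<lambda>m. LINT z|disc. norm (f m z))"
    proof (rule summable_comparison_test'[where N = 0])
      show "summable (\<lambda>m. norm (taylor k m) * r ^ m * B * measure disc (ball 0 1))"
        using S by (intro summable_mult2)
      fix m :: nat
      have "(LINT z|disc. norm (f m z)) \<le> (LINT z|disc. norm (taylor k m) * r ^ m * B)"
        using bd i by (intro integral_mono) auto
      then show "norm (LINT z|disc. norm (f m z)) \<le> norm (taylor k m) * r ^ m * B * measure disc (ball 0 1)"
        by (simp add: mult_ac)
    qed
  qed
  moreover have "(LINT z|disc. (\<Sum>m. f m z)) = (LINT z|disc. k (of_real r * z) * u z)"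
  proof (rule Bochner_Integration.integral_cong)
    fix z assume "z \<in> space disc"
    then have "(\<lambda>m. taylor k m * (of_real r * z) ^ m) sums k (of_real r * z)"
      using r by (intro taylor_sums[OF k] dilation_in_ball) auto
    then have "(\<lambda>m. taylor k m * (of_real r * z) ^ m * u z) sums (k (of_real r * z) * u z)"
      by (rule sums_mult2)
    then show "(\<Sum>m. f m z) = k (of_real r * z) * u z"
      by (simp add: f_def sums_iff power_mult_distrib mult_ac)
  qed simp
  ultimately show ?thesis by (simp add: f_def[abs_def])
qed

text \<open>Orthogonality of the monomials leaves a single term of the preceding series.\<close>

lemma taylor_eq_integral:
  assumes k: "k holomorphic_on ball 0 1" and r: "0 < r" "r < 1"
  shows "(LINT z|disc. k (of_real r * z) * cnj z ^ m) = taylor k m * of_real (r ^ m * disc_moment m)"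
proof -
  have "(\<lambda>j. taylor k j * of_real r ^ j * (LINT z|disc. z ^ j * cnj z ^ m))
           sums (LINT z|disc. k (of_real r * z) * cnj z ^ m)"
    by (rule dilation_pairing_sums[OF k r, of _ 1])
      (auto intro!: continuous_on_imp_measurable_disc continuous_intros simp: norm_power power_le_one)
  moreover have "(\<lambda>j. taylor k j * of_real r ^ j * (LINT z|disc. z ^ j * cnj z ^ m))
     sums (\<Sum>j\<in>{m}. taylor k j * of_real r ^ j * (LINT z|disc. z ^ j * cnj z ^ m))"
    by (rule sums_finite) (auto simp: integral_disc_monomial)
  ultimately have "(LINT z|disc. k (of_real r * z) * cnj z ^ m)
      = (\<Sum>j\<in>{m}. taylor k j * of_real r ^ j * (LINT z|disc. z ^ j * cnj z ^ m))"
    by (rule sums_unique2)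
  then show ?thesis by (simp add: disc_moment_eq)
qed

section \<open>Dilations and growth bounds in the Bergman space\<close>

lemma bergman1_iff: "f \<in> bergman1 \<longleftrightarrow> f holomorphic_on ball 0 1 \<and> integrable disc f"
  by (simp add: bergman1_def integrable_disc)

lemma bergman1_norm_eq: "bergman1_norm f = (LINT z|disc. norm (f z)) / pi"
  by (simp add: bergman1_norm_def integral_disc)

lemma bergman1_dilation:
  assumes "k \<in> bergman1" "0 < r" "r < 1"
  shows "(\<lambda>z. k (of_real r * z)) \<in> bergman1"
proof -
  have k: "k holomorphic_on ball 0 1" using assms by (simp add: bergman1_iff)
  obtain B where "\<And>z. z \<in> ball 0 1 \<Longrightarrow> norm (k (of_real r * z)) \<le> B"
    using dilation_bounded[OF k assms(2,3)] by blast
  then show ?thesis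
    unfolding bergman1_iff using dilation_holomorphic[OF k, of r] assms
    by (intro conjI integrable_disc_bounded[of _ B] continuous_on_imp_measurable_disc
        holomorphic_on_imp_continuous_on) auto
qed

lemma bergman1_norm_dilation:
  assumes "k \<in> bergman1" "0 < r" "r < 1"
  shows "bergman1_norm (\<lambda>z. k (of_real r * z))
           = (LINT z|disc. indicator (ball 0 r) z * norm (k z)) / (pi * r\<^sup>2)"
proof -
  have "k \<in> borel_measurable disc" using assms by (auto simp: bergman1_iff)
  then have m: "(\<lambda>z. norm (k z)) \<in> borel_measurable disc" by auto
  show ?thesis
    using integral_disc_dilate[OF m, of r] assms by (simp add: bergman1_norm_eq)
qed

text \<open>The shift by 2 keeps the radius positive at n = 0.\<close>

definition radius_seq :: "nat \<Rightarrow> real" where "radius_seq n = 1 - 1 / real (n + 2)"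

lemma radius_seq: "0 < radius_seq n" "radius_seq n < 1" "radius_seq \<longlonglongrightarrow> 1"
proof -
  show "0 < radius_seq n" "radius_seq n < 1" by (auto simp: radius_seq_def field_simps)
  show "radius_seq \<longlonglongrightarrow> 1" unfolding radius_seq_def by real_asymp
qed

lemma radius_seq_limit: "k holomorphic_on ball 0 1 \<Longrightarrow> z \<in> ball 0 1 \<Longrightarrow>
   (\<lambda>n. k (of_real (radius_seq n) * z)) \<longlonglongrightarrow> k z"
  for k :: "complex \<Rightarrow> complex"
  by (rule continuous_on_tendsto_compose[where s = "ball 0 1", OF holomorphic_on_imp_continuous_on])
    (auto intro!: tendsto_eq_intros radius_seq(3) always_eventually dilation_in_ball[simplified]
      radius_seq(1) less_imp_le[OF radius_seq(2)])

text \<open>Scaling moves the dilation from the function to the domain; the integrals over growing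
  balls are then dominated by the norm of \<open>k\<close>.\<close>

lemma bergman1_norm_dilation_tendsto:
  assumes k: "k \<in> bergman1"
  shows "(\<lambda>n. bergman1_norm (\<lambda>z. k (of_real (radius_seq n) * z))) \<longlonglongrightarrow> bergman1_norm k"
proof -
  have i: "integrable disc k" using k by (simp add: bergman1_iff)
  have "(\<lambda>n. LINT z|disc. indicator (ball 0 (radius_seq n)) z * norm (k z)) \<longlonglongrightarrow> (LINT z|disc. norm (k z))"
  proof (rule integral_dominated_convergence[where w = "\<lambda>z. norm (k z)"])
    show "AE z in disc. (\<lambda>n. indicator (ball 0 (radius_seq n)) z * norm (k z)) \<longlonglongrightarrow> norm (k z)"
    proof (intro AE_I2)
      fix z :: complex assume "z \<in> space disc"
      then have "\<forall>\<^sub>F n in sequentially. norm z < radius_seq n"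
        using order_tendstoD(1)[OF radius_seq(3), of "norm z"] by simp
      then have "\<forall>\<^sub>F n in sequentially. indicator (ball 0 (radius_seq n)) z * norm (k z) = norm (k z)"
        by eventually_elim auto
      then show "(\<lambda>n. indicator (ball 0 (radius_seq n)) z * norm (k z)) \<longlonglongrightarrow> norm (k z)"
        by (rule tendsto_eventually)
    qed
    show "(\<lambda>z. indicator (ball 0 (radius_seq n)) z * norm (k z)) \<in> borel_measurable disc" for n
      using i by (intro borel_measurable_times borel_measurable_disc[of "indicator _"]
          borel_measurable_indicator) auto
  qed (use i in \<open>auto simp: indicator_def\<close>)
  then have "(\<lambda>n. (LINT z|disc. indicator (ball 0 (radius_seq n)) z * norm (k z)) / (pi * (radius_seq n)\<^sup>2))
      \<longlonglongrightarrow> (LINT z|disc. norm (k z)) / (pi * 1\<^sup>2)"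
    by (intro tendsto_intros radius_seq(3)) auto
  then show ?thesis
    using bergman1_norm_dilation[OF k radius_seq(1,2)] by (simp add: bergman1_norm_eq)
qed

lemma integral_norm_pairing_le:
  fixes u k :: "complex \<Rightarrow> complex"
  assumes u: "u \<in> borel_measurable disc" "\<And>z. z \<in> ball 0 1 \<Longrightarrow> norm (u z) \<le> B"
    and k: "integrable disc k"
  shows "integrable disc (\<lambda>z. u z * k z)" "norm (LINT z|disc. u z * k z) \<le> B * (LINT z|disc. norm (k z))"
proof -
  have B: "norm (u z * k z) \<le> norm (B * norm (k z))" if "z \<in> ball 0 1" for z
    using mult_right_mono[OF u(2)[OF that], of "norm (k z)"] by (simp add: norm_mult)
  have ik: "integrable disc (\<lambda>z. B * norm (k z))" using k by simp
  show i: "integrable disc (\<lambda>z. u z * k z)"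
    by (rule Bochner_Integration.integrable_bound[OF ik]) (use u(1) k B in auto)
  have B0: "B \<ge> 0" using u(2)[of 0] norm_ge_zero[of "u 0"] by (simp del: norm_ge_zero)
  have "norm (LINT z|disc. u z * k z) \<le> (LINT z|disc. B * norm (k z))"
    by (rule Bochner_Integration.integral_norm_bound_integral[OF i ik]) (use B B0 in \<open>force\<close>)
  then show "norm (LINT z|disc. u z * k z) \<le> B * (LINT z|disc. norm (k z))"
    by simp
qed

text \<open>The coefficient integral tests a dilation against a function bounded by 1, and the
  moment it is divided by is at least of order 1 / (m + 1). The radius then tends to 1. The linear
  growth found here is the source of the weight m + 1 in the compactness test.\<close>

lemma taylor_bound:
  assumes k: "k \<in> bergman1"
  shows "norm (taylor k m) \<le> 8 * real (m + 1) * bergman1_norm k"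
proof -
  have h: "k holomorphic_on ball 0 1" using k by (simp add: bergman1_iff)
  have le: "norm (taylor k m) * (radius_seq n ^ m * disc_moment m)
      \<le> pi * bergman1_norm (\<lambda>z. k (of_real (radius_seq n) * z))" for n
  proof -
    have d: "disc_moment m \<ge> 0" using disc_moment_ge[of m] by (rule order_trans[rotated]) simp
    have "norm (taylor k m) * (radius_seq n ^ m * disc_moment m)
      = norm (LINT z|disc. cnj z ^ m * k (of_real (radius_seq n) * z))"
      using taylor_eq_integral[OF h radius_seq(1,2), of n m] radius_seq(1,2)[of n] d
      by (simp add: mult.commute norm_mult norm_power)
    also have "\<dots> \<le> 1 * (LINT z|disc. norm (k (of_real (radius_seq n) * z)))"
      using bergman1_dilation[OF k radius_seq(1,2), of n]
      by (intro integral_norm_pairing_le)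
       (auto simp: bergman1_iff norm_power power_le_one intro!: continuous_on_imp_measurable_disc continuous_intros)
    finally show ?thesis by (simp add: bergman1_norm_eq)
  qed
  have "(\<lambda>n. norm (taylor k m) * (radius_seq n ^ m * disc_moment m))
      \<longlonglongrightarrow> norm (taylor k m) * (1 ^ m * disc_moment m)"
    by (intro tendsto_intros radius_seq)
  moreover have "(\<lambda>n. pi * bergman1_norm (\<lambda>z. k (of_real (radius_seq n) * z))) \<longlonglongrightarrow> pi * bergman1_norm k"
    by (intro tendsto_intros bergman1_norm_dilation_tendsto k)
  ultimately have "norm (taylor k m) * (1 ^ m * disc_moment m) \<le> pi * bergman1_norm k"
    by (rule LIMSEQ_le) (use le in auto)
  then have "norm (taylor k m) * (pi / (8 * real (m + 1))) \<le> pi * bergman1_norm k"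
    using mult_left_mono[OF disc_moment_ge[of m], of "norm (taylor k m)"] by simp
  then have "pi * norm (taylor k m) \<le> pi * (8 * real (m + 1) * bergman1_norm k)"
    by (simp add: field_simps)
  then show ?thesis by (rule mult_left_le_imp_le) simp
qed

lemma bergman1_norm_nonneg: "bergman1_norm f \<ge> 0"
  by (simp add: bergman1_norm_eq)

text \<open>The coefficient bound dominates the power series on |z| \<le> r by the derivative of the
  geometric series. Hence norm-bounded families are locally uniformly bounded.\<close>

lemma bergman1_pointwise_bound:
  assumes "r < 1"
  obtains C where "\<And>k (z::complex). k \<in> bergman1 \<Longrightarrow> norm z \<le> r \<Longrightarrow> norm (k z) \<le> C * bergman1_norm k"
proof (rule that)
  fix k :: "complex \<Rightarrow> complex" and z :: complex assume k: "k \<in> bergman1" and z: "norm z \<le> r"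
  have r0: "0 \<le> r" using z norm_ge_zero order_trans by blast
  have h: "k holomorphic_on ball 0 1" using k by (simp add: bergman1_iff)
  have S: "summable (\<lambda>m. 8 * real (m + 1) * r ^ m)"
  proof -
    have "summable (\<lambda>m. diffs (\<lambda>_. 1::real) m * r ^ m)"
      by (rule termdiff_converges[of _ 1]) (use assms r0 in \<open>auto simp: summable_geometric\<close>)
    from summable_mult[OF this, of 8] show ?thesis by (simp add: diffs_def mult_ac)
  qed
  have zb: "z \<in> ball 0 1" using z assms by simp
  have b: "norm (taylor k m * z ^ m) \<le> 8 * real (m + 1) * r ^ m * bergman1_norm k" for m
  proof -
    have "norm (taylor k m * z ^ m) \<le> (8 * real (m + 1) * bergman1_norm k) * r ^ m"
      unfolding norm_mult norm_power
      by (intro mult_mono taylor_bound[OF k] power_mono z) (auto simp: bergman1_norm_nonneg)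
    then show ?thesis by (simp add: mult_ac)
  qed
  have "norm (k z) = norm (\<Sum>m. taylor k m * z ^ m)"
    using taylor_sums[OF h zb] by (simp add: sums_iff)
  also have "\<dots> \<le> (\<Sum>m. 8 * real (m + 1) * r ^ m * bergman1_norm k)"
    by (rule norm_suminf_le[OF b summable_mult2[OF S]])
  also have "\<dots> = (\<Sum>m. 8 * real (m + 1) * r ^ m) * bergman1_norm k"
    by (rule suminf_mult2[OF S, symmetric])
  finally show "norm (k z) \<le> (\<Sum>m. 8 * real (m + 1) * r ^ m) * bergman1_norm k" .
qed

text \<open>The case p = 1 of the Brezis-Lieb lemma. The reverse triangle inequality bounds the
  difference of the two integrands by \<open>norm (h x)\<close>, so dominated convergence works
  without a common majorant of the \<open>f n\<close>.\<close>

lemma brezis_lieb: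
  fixes f :: "nat \<Rightarrow> 'a \<Rightarrow> 'b::{banach, second_countable_topology}"
  assumes f: "\<And>n. integrable M (f n)" and h: "integrable M h"
    and lim: "\<And>x. x \<in> space M \<Longrightarrow> (\<lambda>n. f n x) \<longlonglongrightarrow> h x"
  shows "(\<lambda>n. (LINT x|M. norm (f n x)) - (LINT x|M. norm (f n x - h x))) \<longlonglongrightarrow> (LINT x|M. norm (h x))"
proof -
  have "(\<lambda>n. LINT x|M. norm (f n x) - norm (f n x - h x)) \<longlonglongrightarrow> (LINT x|M. norm (h x))"
  proof (rule integral_dominated_convergence[where w = "\<lambda>x. norm (h x)"])
    show "AE x in M. (\<lambda>n. norm (f n x) - norm (f n x - h x)) \<longlonglongrightarrow> norm (h x)"
      by (rule AE_I2) (auto intro!: tendsto_eq_intros lim)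
    show "AE x in M. norm (norm (f n x) - norm (f n x - h x)) \<le> norm (h x)" for n
      by (rule AE_I2) (metis norm_triangle_ineq3 real_norm_def diff_diff_eq2 add_diff_cancel_left')
  qed (use f h in auto)
  then show ?thesis using f h by simp
qed

text \<open>Pointwise convergence together with convergence of the norms gives convergence in norm,
  by the preceding lemma.\<close>

lemma bergman1_dilation_L1:
  assumes k: "k \<in> bergman1"
  shows "(\<lambda>n. bergman1_norm (\<lambda>z. k (of_real (radius_seq n) * z) - k z)) \<longlonglongrightarrow> 0"
proof -
  let ?d = "\<lambda>n z. k (of_real (radius_seq n) * z)"
  have "(\<lambda>n. (LINT z|disc. norm (?d n z)) - (LINT z|disc. norm (?d n z - k z))) \<longlonglongrightarrow> (LINT z|disc. norm (k z))"
    by (rule brezis_lieb)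
     (use k bergman1_dilation[OF k radius_seq(1,2)] radius_seq_limit in \<open>auto simp: bergman1_iff\<close>)
  from tendsto_divide[OF this tendsto_const[of pi]]
  have "(\<lambda>n. bergman1_norm (?d n) - bergman1_norm (\<lambda>z. ?d n z - k z)) \<longlonglongrightarrow> bergman1_norm k"
    by (simp add: bergman1_norm_eq diff_divide_distrib)
  from tendsto_diff[OF bergman1_norm_dilation_tendsto[OF k] this] show ?thesis by simp
qed

section \<open>Compact symbols\<close>

text \<open>Symbols \<open>u\<close> that induce compact functionals on \<open>A\<^sup>1\<close>: they cannot see any mass that escapes
  to the boundary.\<close>

definition compact_symbol :: "(complex \<Rightarrow> complex) \<Rightarrow> bool" where
  "compact_symbol u \<longleftrightarrow> u \<in> borel_measurable disc \<and> (\<exists>B. \<forall>z\<in>ball 0 1. norm (u z) \<le> B) \<and>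
     (\<forall>k B. (\<forall>n. k n \<in> bergman1 \<and> bergman1_norm (k n) \<le> B) \<longrightarrow>
        (\<forall>z\<in>ball 0 1. (\<lambda>n. k n z) \<longlonglongrightarrow> 0) \<longrightarrow>
        (\<lambda>n. LINT z|disc. u z * k n z) \<longlonglongrightarrow> 0)"

lemma compact_symbolI:
  assumes "u \<in> borel_measurable disc" "\<And>z. z \<in> ball 0 1 \<Longrightarrow> norm (u z) \<le> B"
    and "\<And>k C. (\<And>n. k n \<in> bergman1) \<Longrightarrow> (\<And>n. bergman1_norm (k n) \<le> C) \<Longrightarrow>
      (\<And>z. z \<in> ball 0 1 \<Longrightarrow> (\<lambda>n. k n z) \<longlonglongrightarrow> 0) \<Longrightarrow> (\<lambda>n. LINT z|disc. u z * k n z) \<longlonglongrightarrow> 0"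
  shows "compact_symbol u"
  using assms unfolding compact_symbol_def by blast

lemma compact_symbol_measurable: "compact_symbol u \<Longrightarrow> u \<in> borel_measurable disc"
  by (simp add: compact_symbol_def)

lemma compact_symbol_bounded:
  assumes "compact_symbol u"
  obtains B where "\<And>z. z \<in> ball 0 1 \<Longrightarrow> norm (u z) \<le> B"
  using assms unfolding compact_symbol_def by blast

lemma compact_symbolD:
  assumes "compact_symbol u" "\<And>n. k n \<in> bergman1" "\<And>n. bergman1_norm (k n) \<le> C"
    "\<And>z. z \<in> ball 0 1 \<Longrightarrow> (\<lambda>n. k n z) \<longlonglongrightarrow> 0"
  shows "(\<lambda>n. LINT z|disc. u z * k n z) \<longlonglongrightarrow> 0"
  using assms unfolding compact_symbol_def by blast

lemma compact_symbol_integrable: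
  assumes "compact_symbol u" "k \<in> bergman1"
  shows "integrable disc (\<lambda>z. u z * k z)"
proof -
  obtain B where "\<And>z. z \<in> ball 0 1 \<Longrightarrow> norm (u z) \<le> B"
    using compact_symbol_bounded[OF assms(1)] by blast
  then show ?thesis
    using assms(2) by (intro integral_norm_pairing_le(1)[OF compact_symbol_measurable[OF assms(1)]])
      (auto simp: bergman1_iff)
qed

lemma compact_symbol_add:
  assumes u: "compact_symbol u" and v: "compact_symbol v"
  shows "compact_symbol (\<lambda>z. u z + v z)"
proof -
  obtain B where B: "\<And>z. z \<in> ball 0 1 \<Longrightarrow> norm (u z) \<le> B"
    using compact_symbol_bounded[OF u] by blast
  obtain B' where B': "\<And>z. z \<in> ball 0 1 \<Longrightarrow> norm (v z) \<le> B'"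
    using compact_symbol_bounded[OF v] by blast
  show ?thesis
  proof (rule compact_symbolI[of _ "B + B'"])
    show "norm (u z + v z) \<le> B + B'" if "z \<in> ball 0 1" for z
      using norm_triangle_mono[OF B[OF that] B'[OF that]] .
    fix k C assume k: "\<And>n. k n \<in> bergman1" "\<And>n. bergman1_norm (k n) \<le> C"
      "\<And>z. z \<in> ball 0 1 \<Longrightarrow> (\<lambda>n. k n z) \<longlonglongrightarrow> 0"
    show "(\<lambda>n. LINT z|disc. (u z + v z) * k n z) \<longlonglongrightarrow> 0"
      using tendsto_add[OF compact_symbolD[OF u k] compact_symbolD[OF v k]]
        compact_symbol_integrable[OF u k(1)] compact_symbol_integrable[OF v k(1)]
      by (simp add: distrib_right)
  qed (use u v compact_symbol_measurable in auto)
qed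

lemma compact_symbol_cmult:
  assumes u: "compact_symbol u"
  shows "compact_symbol (\<lambda>z. c * u z)"
proof -
  obtain B where B: "\<And>z. z \<in> ball 0 1 \<Longrightarrow> norm (u z) \<le> B"
    using compact_symbol_bounded[OF u] by blast
  show ?thesis
  proof (rule compact_symbolI[of _ "norm c * B"])
    fix k C assume k: "\<And>n. k n \<in> bergman1" "\<And>n. bergman1_norm (k n) \<le> C"
      "\<And>z. z \<in> ball 0 1 \<Longrightarrow> (\<lambda>n. k n z) \<longlonglongrightarrow> 0"
    show "(\<lambda>n. LINT z|disc. c * u z * k n z) \<longlonglongrightarrow> 0"
      using tendsto_mult[OF tendsto_const[of c] compact_symbolD[OF u k]]
      by (simp add: mult.assoc)
  qed (use B compact_symbol_measurable[OF u] in \<open>auto simp: norm_mult mult_left_mono\<close>)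
qed

lemma compact_symbol_0: "compact_symbol (\<lambda>z. 0)"
  by (rule compact_symbolI[of _ 0]) auto

lemma compact_symbol_sum:
  "(\<And>i. i \<in> I \<Longrightarrow> compact_symbol (u i)) \<Longrightarrow> compact_symbol (\<lambda>z. \<Sum>i\<in>I. u i z)"
  by (induction I rule: infinite_finite_induct) (auto intro: compact_symbol_0 compact_symbol_add)

lemma dilated_pointwise_bound:
  assumes "r < 1"
  obtains M where "\<And>k z C. k \<in> bergman1 \<Longrightarrow> bergman1_norm k \<le> C \<Longrightarrow> norm (z::complex) \<le> r \<Longrightarrow> norm (k z) \<le> M * C"
proof -
  obtain M where M: "\<And>k (z::complex). k \<in> bergman1 \<Longrightarrow> norm z \<le> r \<Longrightarrow> norm (k z) \<le> M * bergman1_norm k"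
    using bergman1_pointwise_bound[OF assms] by blast
  show ?thesis
  proof (rule that[of "\<bar>M\<bar>"])
    fix k :: "complex \<Rightarrow> complex" and z :: complex and C
    assume a: "k \<in> bergman1" "bergman1_norm k \<le> C" "norm z \<le> r"
    have "M * bergman1_norm k \<le> \<bar>M\<bar> * C"
      using a(2) bergman1_norm_nonneg[of k] by (intro mult_mono) auto
    then show "norm (k z) \<le> \<bar>M\<bar> * C" using M[OF a(1,3)] by linarith
  qed
qed

text \<open>On |z| \<le> r a norm-bounded sequence is uniformly bounded, so pointwise convergence
  suffices for dominated convergence.\<close>

lemma compact_symbol_compact_support:
  assumes u: "u \<in> borel_measurable disc" "\<And>z. z \<in> ball 0 1 \<Longrightarrow> norm (u z) \<le> B"
    and r: "r < 1" "\<And>z. z \<in> ball 0 1 \<Longrightarrow> r < norm z \<Longrightarrow> u z = 0"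
  shows "compact_symbol u"
proof (rule compact_symbolI[OF u])
  fix k C assume k: "\<And>n. k n \<in> bergman1" "\<And>n. bergman1_norm (k n) \<le> C"
    "\<And>z. z \<in> ball 0 1 \<Longrightarrow> (\<lambda>n. k n z) \<longlonglongrightarrow> 0"
  obtain M where M: "\<And>k z C. k \<in> bergman1 \<Longrightarrow> bergman1_norm k \<le> C \<Longrightarrow> norm (z::complex) \<le> r \<Longrightarrow> norm (k z) \<le> M * C"
    using dilated_pointwise_bound[OF r(1)] by metis
  have "(\<lambda>n. LINT z|disc. u z * k n z) \<longlonglongrightarrow> (LINT z|disc. 0)"
  proof (rule integral_dominated_convergence[where w = "\<lambda>_. \<bar>B\<bar> * \<bar>M * C\<bar>"])
    show "(\<lambda>z. u z * k n z) \<in> borel_measurable disc" for n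
      using k(1)[of n] u(1) by (auto simp: bergman1_iff)
    show "AE z in disc. (\<lambda>n. u z * k n z) \<longlonglongrightarrow> 0"
      using k(3) by (intro AE_I2) (auto intro!: tendsto_eq_intros)
    have "norm (u z * k n z) \<le> \<bar>B\<bar> * \<bar>M * C\<bar>" if z: "z \<in> ball 0 1" for n z
    proof (cases "r < norm z")
      case True
      then show ?thesis using r(2)[OF z] by simp
    next
      case False
      then have "norm (k n z) \<le> \<bar>M * C\<bar>" using M[OF k(1,2), of z n] by simp
      moreover have "norm (u z) \<le> \<bar>B\<bar>" using u(2)[OF z] by simp
      ultimately show ?thesis unfolding norm_mult by (intro mult_mono) auto
    qed
    then show "AE z in disc. norm (u z * k n z) \<le> \<bar>B\<bar> * \<bar>M * C\<bar>" for n
      by (intro AE_I2) auto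
  qed auto
  then show "(\<lambda>n. LINT z|disc. u z * k n z) \<longlonglongrightarrow> 0" by simp
qed

lemma compact_symbol_closed:
  assumes u: "u \<in> borel_measurable disc" "\<And>z. z \<in> ball 0 1 \<Longrightarrow> norm (u z) \<le> B"
    and ap: "\<And>e. e > 0 \<Longrightarrow> \<exists>v. compact_symbol v \<and> (\<forall>z\<in>ball 0 1. norm (u z - v z) \<le> e)"
  shows "compact_symbol u"
proof (rule compact_symbolI[OF u])
  fix k C assume k: "\<And>n. k n \<in> bergman1" "\<And>n. bergman1_norm (k n) \<le> C"
    "\<And>z. z \<in> ball 0 1 \<Longrightarrow> (\<lambda>n. k n z) \<longlonglongrightarrow> 0"
  have C: "C \<ge> 0" using bergman1_norm_nonneg[of "k 0"] k(2)[of 0] by linarith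
  show "(\<lambda>n. LINT z|disc. u z * k n z) \<longlonglongrightarrow> 0"
  proof (rule LIMSEQ_I)
    fix e :: real assume e: "e > 0"
    \<comment> \<open>The error from replacing \<open>u\<close> by \<open>v\<close> is at most d *
      pi * C, which must stay below e / 2. The added 1 covers C = 0.\<close>
    define d where "d = e / (2 * (pi * C + 1))"
    have d: "d > 0" "d * (pi * C) \<le> e / 2"
      using e C by (auto simp: d_def field_simps add_pos_nonneg)
    obtain v where v: "compact_symbol v" "\<forall>z\<in>ball 0 1. norm (u z - v z) \<le> d"
      using ap[OF d(1)] by blast
    obtain N where N: "\<And>n. n \<ge> N \<Longrightarrow> norm (LINT z|disc. v z * k n z) < e / 2"
      using LIMSEQ_D[OF compact_symbolD[OF v(1) k], of "e / 2"] e by auto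
    have "norm (LINT z|disc. u z * k n z) < e" if "n \<ge> N" for n
    proof -
      have ik: "integrable disc (k n)" using k(1) by (simp add: bergman1_iff)
      have m: "(\<lambda>z. u z - v z) \<in> borel_measurable disc"
        using u(1) compact_symbol_measurable[OF v(1)] by auto
      have "(LINT z|disc. u z * k n z) = (LINT z|disc. (u z - v z) * k n z) + (LINT z|disc. v z * k n z)"
        using compact_symbol_integrable[OF v(1) k(1)] integral_norm_pairing_le(1)[OF m _ ik, of d] v(2)
        by (subst Bochner_Integration.integral_add[symmetric]) (auto simp: algebra_simps)
      moreover have "norm (LINT z|disc. (u z - v z) * k n z) \<le> d * (LINT z|disc. norm (k n z))"
        using v(2) by (intro integral_norm_pairing_le(2)[OF m _ ik]) auto
      moreover have "d * (LINT z|disc. norm (k n z)) \<le> d * (pi * C)"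
        using d k(2)[of n] by (intro mult_left_mono) (auto simp: bergman1_norm_eq field_simps)
      ultimately show ?thesis
        using N[OF that] d(2) norm_triangle_ineq[of "LINT z|disc. (u z - v z) * k n z" "LINT z|disc. v z * k n z"]
        by simp
    qed
    then show "\<exists>no. \<forall>n\<ge>no. norm ((LINT z|disc. u z * k n z) - 0) < e" by auto
  qed
qed

section \<open>The moment test for compactness and continuous symbols\<close>

lemma tannery_sequence:
  fixes a :: "nat \<Rightarrow> nat \<Rightarrow> complex"
  assumes "\<And>m. (\<lambda>n. a m n) \<longlonglongrightarrow> b m" "\<And>m n. norm (a m n) \<le> M m" "summable M"
  shows "(\<lambda>n. \<Sum>m. a m n) \<longlonglongrightarrow> (\<Sum>m. b m)"
proof -
  have "\<forall>\<^sub>F (k, n) in at_top \<times>\<^sub>F sequentially. norm (a k n) \<le> M k"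
    by (rule always_eventually) (use assms(2) in auto)
  from tannerys_theorem[OF assms(1) this assms(3)] show ?thesis by simp
qed

text \<open>A coefficient can be read off at a fixed radius inside the disc, here 1/2, where the
  sequence is uniformly bounded and dominated convergence applies.\<close>

lemma taylor_tendsto_0:
  assumes k: "\<And>n. k n \<in> bergman1" "\<And>n. bergman1_norm (k n) \<le> C"
    "\<And>z. z \<in> ball 0 1 \<Longrightarrow> (\<lambda>n. k n z) \<longlonglongrightarrow> 0"
  shows "(\<lambda>n. taylor (k n) m) \<longlonglongrightarrow> 0"
proof -
  have h: "k n holomorphic_on ball 0 1" for n using k(1) by (simp add: bergman1_iff)
  obtain M where M: "\<And>k z C. k \<in> bergman1 \<Longrightarrow> bergman1_norm k \<le> C \<Longrightarrow> norm (z::complex) \<le> 1/2 \<Longrightarrow> norm (k z) \<le> M * C"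
    using dilated_pointwise_bound[of "1/2"] by force
  let ?r = "1/2 :: real"
  have db: "of_real ?r * z \<in> ball 0 1" if "z \<in> ball 0 1" for z :: complex
    using that by (auto simp: norm_mult)
  have "(\<lambda>n. LINT z|disc. k n (of_real ?r * z) * cnj z ^ m) \<longlonglongrightarrow> (LINT z|disc. 0)"
  proof (rule integral_dominated_convergence[where w = "\<lambda>_. M * C"])
    show "(\<lambda>z. k n (of_real ?r * z) * cnj z ^ m) \<in> borel_measurable disc" for n
      using bergman1_dilation[OF k(1), of ?r n]
      by (intro continuous_on_imp_measurable_disc continuous_intros holomorphic_on_imp_continuous_on)
        (auto simp: bergman1_iff)
    show "AE z in disc. (\<lambda>n. k n (of_real ?r * z) * cnj z ^ m) \<longlonglongrightarrow> 0"
      using k(3)[OF db] by (intro AE_I2) (auto intro!: tendsto_eq_intros)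
    have "norm (k n (of_real ?r * z) * cnj z ^ m) \<le> M * C" if z: "z \<in> ball 0 1" for n z
    proof -
      have "norm (k n (of_real ?r * z)) \<le> M * C"
        using z by (intro M k) (auto simp: norm_mult)
      moreover have "norm (cnj z ^ m) \<le> 1" using z by (simp add: norm_power power_le_one)
      ultimately have "norm (k n (of_real ?r * z)) * norm (cnj z ^ m) \<le> (M * C) * 1"
        using norm_ge_zero order_trans by (intro mult_mono) blast+
      then show ?thesis by (simp add: norm_mult)
    qed
    then show "AE z in disc. norm (k n (of_real ?r * z) * cnj z ^ m) \<le> M * C" for n
      by (intro AE_I2) auto
  qed auto
  then have "(\<lambda>n. taylor (k n) m * of_real (?r ^ m * disc_moment m)) \<longlonglongrightarrow> 0"
    using taylor_eq_integral[OF h, of ?r _ m] by simp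
  moreover have "complex_of_real (?r ^ m * disc_moment m) \<noteq> 0"
  proof -
    have "0 < pi / (8 * real (m + 1))" by simp
    then have "disc_moment m > 0" using disc_moment_ge[of m] by linarith
    then show ?thesis by simp
  qed
  ultimately have "(\<lambda>n. taylor (k n) m * of_real (?r ^ m * disc_moment m) / of_real (?r ^ m * disc_moment m))
    \<longlonglongrightarrow> 0 / complex_of_real (?r ^ m * disc_moment m)"
    by (intro tendsto_divide tendsto_const)
  with \<open>complex_of_real (?r ^ m * disc_moment m) \<noteq> 0\<close> show ?thesis
    by (simp only: nonzero_mult_div_cancel_right div_0 simp_thms)
qed

text \<open>The series of \<open>k\<close> cannot be integrated directly. It is integrated for
  dilations; as the radius tends to 1, the sum converges by Tannery with the majorant supplied by
  \<open>S\<close> and the coefficient bound, and the integral converges because dilations converge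
  in L1.\<close>

lemma pairing_sums:
  assumes u: "u \<in> borel_measurable disc" "\<And>z. z \<in> ball 0 1 \<Longrightarrow> norm (u z) \<le> B"
    and S: "summable (\<lambda>m. real (m + 1) * norm (LINT z|disc. z ^ m * u z))"
    and k: "k \<in> bergman1"
  shows "(LINT z|disc. u z * k z) = (\<Sum>m. taylor k m * (LINT z|disc. z ^ m * u z))"
proof -
  define a where "a m = (LINT z|disc. z ^ m * u z)" for m
  have h: "k holomorphic_on ball 0 1" "integrable disc k" using k by (auto simp: bergman1_iff)
  let ?d = "\<lambda>n z. k (of_real (radius_seq n) * z)"
  have id: "integrable disc (?d n)" for n
    using bergman1_dilation[OF k radius_seq(1,2)] by (simp add: bergman1_iff)
  have "norm (taylor k m * of_real (radius_seq n) ^ m * a m)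
      \<le> 8 * bergman1_norm k * (real (m + 1) * norm (a m))" for m n
  proof -
    have "norm (taylor k m) * (radius_seq n) ^ m \<le> (8 * real (m + 1) * bergman1_norm k) * 1"
      using radius_seq(1,2)[of n] taylor_bound[OF k]
      by (intro mult_mono power_le_one) (auto simp: bergman1_norm_nonneg)
    from mult_right_mono[OF this, of "norm (a m)"] show ?thesis
      using radius_seq(1,2)[of n] by (simp add: norm_mult norm_power algebra_simps)
  qed
  then have "(\<lambda>n. \<Sum>m. taylor k m * of_real (radius_seq n) ^ m * a m) \<longlonglongrightarrow> (\<Sum>m. taylor k m * 1 ^ m * a m)"
    using S radius_seq(3)
    by (intro tannery_sequence[where M = "\<lambda>m. 8 * bergman1_norm k * (real (m + 1) * norm (a m))"]
        summable_mult tendsto_mult tendsto_const tendsto_power tendsto_of_real[of _ 1, simplified])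
      (auto simp: a_def)
  moreover have "(\<Sum>m. taylor k m * of_real (radius_seq n) ^ m * a m) = (LINT z|disc. u z * ?d n z)" for n
    using dilation_pairing_sums[OF h(1) radius_seq(1,2) u, of n] by (simp add: sums_iff a_def mult.commute)
  ultimately have 1: "(\<lambda>n. LINT z|disc. u z * ?d n z) \<longlonglongrightarrow> (\<Sum>m. taylor k m * a m)" by simp
  have "(\<lambda>n. (LINT z|disc. u z * ?d n z) - (LINT z|disc. u z * k z)) \<longlonglongrightarrow> 0"
  proof (rule Lim_null_comparison)
    have "norm ((LINT z|disc. u z * ?d n z) - (LINT z|disc. u z * k z))
        \<le> B * (pi * bergman1_norm (\<lambda>z. ?d n z - k z))" for n
    proof -
      have "(LINT z|disc. u z * ?d n z) - (LINT z|disc. u z * k z) = (LINT z|disc. u z * (?d n z - k z))"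
        using integral_norm_pairing_le(1)[OF u id, of n] integral_norm_pairing_le(1)[OF u h(2)]
        by (subst Bochner_Integration.integral_diff[symmetric]) (auto simp: algebra_simps)
      then show ?thesis
        using integral_norm_pairing_le(2)[OF u, of "\<lambda>z. ?d n z - k z"] id h(2)
        by (simp add: bergman1_norm_eq)
    qed
    then show "\<forall>\<^sub>F n in sequentially. norm ((LINT z|disc. u z * ?d n z) - (LINT z|disc. u z * k z))
        \<le> B * (pi * bergman1_norm (\<lambda>z. ?d n z - k z))" by simp
    show "(\<lambda>n. B * (pi * bergman1_norm (\<lambda>z. ?d n z - k z))) \<longlonglongrightarrow> 0"
      using bergman1_dilation_L1[OF k] by (auto intro!: tendsto_eq_intros)
  qed
  from tendsto_diff[OF 1 this] have "(\<lambda>n. (LINT z|disc. u z * k z)) \<longlonglongrightarrow> (\<Sum>m. taylor k m * a m)" by simp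
  then show ?thesis unfolding a_def using LIMSEQ_unique tendsto_const by blast
qed

text \<open>Each coefficient of the sequence tends to 0, and the linear coefficient bound turns
  \<open>S\<close> into a majorant uniform in n, so Tannery sends the whole pairing to 0.\<close>

lemma compact_symbol_summable:
  assumes u: "u \<in> borel_measurable disc" "\<And>z. z \<in> ball 0 1 \<Longrightarrow> norm (u z) \<le> B"
    and S: "summable (\<lambda>m. real (m + 1) * norm (LINT z|disc. z ^ m * u z))"
  shows "compact_symbol u"
proof (rule compact_symbolI[OF u])
  fix k C assume k: "\<And>n. k n \<in> bergman1" "\<And>n. bergman1_norm (k n) \<le> C"
    "\<And>z. z \<in> ball 0 1 \<Longrightarrow> (\<lambda>n. k n z) \<longlonglongrightarrow> 0"
  let ?a = "\<lambda>m. LINT z|disc. z ^ m * u z"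
  have "norm (taylor (k n) m * ?a m) \<le> 8 * C * (real (m + 1) * norm (?a m))" for m n
  proof -
    have "norm (taylor (k n) m) \<le> 8 * real (m + 1) * C"
      by (rule order_trans[OF taylor_bound[OF k(1)] mult_left_mono[OF k(2)]]) simp
    from mult_right_mono[OF this, of "norm (?a m)"] show ?thesis
      by (simp add: norm_mult algebra_simps)
  qed
  moreover have "(\<lambda>n. taylor (k n) m * ?a m) \<longlonglongrightarrow> 0" for m
    using tendsto_mult_right[OF taylor_tendsto_0[OF k, of m], of "?a m"] by simp
  ultimately have "(\<lambda>n. \<Sum>m. taylor (k n) m * ?a m) \<longlonglongrightarrow> (\<Sum>m. 0)"
    by (intro tannery_sequence[where M = "\<lambda>m. 8 * C * (real (m + 1) * norm (?a m))"] summable_mult S)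
  moreover have "(LINT z|disc. u z * k n z) = (\<Sum>m. taylor (k n) m * ?a m)" for n
    by (rule pairing_sums[OF u S k(1)])
  ultimately show "(\<lambda>n. LINT z|disc. u z * k n z) \<longlonglongrightarrow> 0"
    by simp
qed

text \<open>By orthogonality only finitely many moments are nonzero.\<close>

lemma compact_symbol_monomial: "compact_symbol (\<lambda>z. z ^ a * cnj z ^ b)"
proof (rule compact_symbol_summable[where B = 1])
  have "(LINT z|disc. z ^ m * (z ^ a * cnj z ^ b)) = 0" if "m \<notin> {..b}" for m
    using integral_disc_monomial[of "m + a" b] that by (simp add: power_add mult_ac)
  then show "summable (\<lambda>m. real (m + 1) * norm (LINT z|disc. z ^ m * (z ^ a * cnj z ^ b)))"
    by (intro summable_finite[of "{..b}"]) auto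
  show "norm (z ^ a * cnj z ^ b) \<le> 1" if "z \<in> ball 0 1" for z :: complex
    using that by (auto simp: norm_mult norm_power power_le_one intro!: mult_le_one)
qed (intro continuous_on_imp_measurable_disc continuous_intros)

text \<open>The factor \<open>v\<close> is kept arbitrary for the induction: in the product case the
  hypothesis for one factor is applied with the other one absorbed into \<open>v\<close>. All
  exponents a, b are carried along because a linear factor raises them.\<close>

lemma real_polynomial_times_compact_symbol:
  assumes "real_polynomial_function p"
    and "\<And>a b. compact_symbol (\<lambda>z. z ^ a * cnj z ^ b * v z)"
  shows "compact_symbol (\<lambda>z. z ^ a * cnj z ^ b * (of_real (p z) * v z))"
  using assms
proof (induction p arbitrary: v a b)
  case (linear f)
  \<comment> \<open>Every real-linear functional on the plane has the form 2 Re (c z) = c z + cnj c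
    * cnj z; this \<open>c\<close> is read off from its values at 1 and \<open>\<i>\<close>.\<close>
  define c where "c = (f 1 - \<i> * f \<i>) / 2"
  interpret bounded_linear f by fact
  have "complex_of_real (f z) = c * z + cnj c * cnj z" for z
  proof -
    have "z = Re z *\<^sub>R 1 + Im z *\<^sub>R \<i>" by (simp add: complex_eq_iff)
    then have "f z = f (Re z *\<^sub>R 1 + Im z *\<^sub>R \<i>)" by (rule arg_cong)
    then have "f z = Re z * f 1 + Im z * f \<i>" by (simp only: add scaleR) simp
    then show ?thesis by (simp add: c_def complex_eq_iff field_simps)
  qed
  then have eq: "z ^ a * cnj z ^ b * (of_real (f z) * v z)
    = c * (z ^ Suc a * cnj z ^ b * v z) + cnj c * (z ^ a * cnj z ^ Suc b * v z)" for z
    by (simp add: algebra_simps)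
  show ?case unfolding eq by (intro compact_symbol_add compact_symbol_cmult linear.prems)
next
  case (const c)
  have eq: "z ^ a * cnj z ^ b * (of_real c * v z) = of_real c * (z ^ a * cnj z ^ b * v z)" for z
    by simp
  show ?case unfolding eq by (intro compact_symbol_cmult const)
next
  case (add f g)
  have eq: "z ^ a * cnj z ^ b * (of_real (f z + g z) * v z)
    = z ^ a * cnj z ^ b * (of_real (f z) * v z) + z ^ a * cnj z ^ b * (of_real (g z) * v z)" for z
    by (simp add: algebra_simps)
  show ?case unfolding eq by (intro compact_symbol_add add)
next
  case (mult f g)
  have eq: "z ^ a * cnj z ^ b * (of_real (f z * g z) * v z)
    = z ^ a * cnj z ^ b * (of_real (f z) * (of_real (g z) * v z))" for z
    by (simp add: algebra_simps)
  show ?case unfolding eq by (intro mult)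
qed

text \<open>Compact symbols are closed under uniform limits, and by Stone-Weierstrass polynomials in
  z and cnj z are dense.\<close>

lemma compact_symbol_continuous:
  assumes u: "continuous_on (cball 0 1) u"
  shows "compact_symbol u"
proof -
  have "compact (u ` cball 0 1)" using u by (intro compact_continuous_image) auto
  then obtain B where B: "\<forall>w\<in>u ` cball 0 1. norm w \<le> B"
    using compact_imp_bounded bounded_iff by metis
  show ?thesis
  proof (rule compact_symbol_closed[of _ B])
    show "u \<in> borel_measurable disc"
      using u by (intro continuous_on_imp_measurable_disc continuous_on_subset[OF u]) auto
    show "norm (u z) \<le> B" if "z \<in> ball 0 1" for z using B that by auto
    fix e :: real assume "e > 0"
    then obtain g where g: "polynomial_function g" "\<And>z. z \<in> cball 0 1 \<Longrightarrow> norm (u z - g z) < e"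
      using Stone_Weierstrass_polynomial_function[of "cball 0 1" u e] u by auto
    have p: "real_polynomial_function (\<lambda>z. Re (g z))" "real_polynomial_function (\<lambda>z. Im (g z))"
      using g(1) unfolding polynomial_function_def o_def
      by (auto intro: bounded_linear_Re bounded_linear_Im)
    have R: "compact_symbol (\<lambda>z. of_real (p z))" if "real_polynomial_function p" for p
      using real_polynomial_times_compact_symbol[OF that, of "\<lambda>_. 1" 0 0] compact_symbol_monomial by simp
    have "compact_symbol (\<lambda>z. of_real (Re (g z)) + \<i> * of_real (Im (g z)))"
      by (intro compact_symbol_add compact_symbol_cmult R p)
    then have "compact_symbol g" by (simp add: complex_eq[symmetric])
    then show "\<exists>v. compact_symbol v \<and> (\<forall>z\<in>ball 0 1. norm (u z - v z) \<le> e)"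
      using g(2) by (intro exI[of _ g]) (force intro: less_imp_le)
  qed
qed

text \<open>Only behaviour near the circle counts: subtracting a Tietze extension \<open>V\<close>
  of the boundary part leaves a symbol supported in |z| \<le> r.\<close>

lemma compact_symbol_extends_continuously:
  assumes u: "u \<in> borel_measurable disc" "\<And>z. z \<in> ball 0 1 \<Longrightarrow> norm (u z) \<le> B"
    and r: "r < 1" and v: "continuous_on {z. r \<le> norm z \<and> norm z \<le> 1} v"
    and eq: "\<And>z. r \<le> norm z \<Longrightarrow> norm z < 1 \<Longrightarrow> u z = v z"
  shows "compact_symbol u"
proof -
  have "closed {z::complex. r \<le> norm z \<and> norm z \<le> 1}"
    unfolding Collect_conj_eq by (intro closed_Int closed_Collect_le continuous_intros)
  then obtain V where V: "continuous_on UNIV V" "\<And>z. r \<le> norm z \<and> norm z \<le> 1 \<Longrightarrow> V z = v z"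
    using Tietze_unbounded[OF v, of UNIV] by (auto simp: subset_UNIV)
  have cV: "compact_symbol V" by (rule compact_symbol_continuous) (rule continuous_on_subset[OF V(1)], simp)
  obtain B' where B': "\<And>z. z \<in> ball 0 1 \<Longrightarrow> norm (V z) \<le> B'"
    using compact_symbol_bounded[OF cV] by blast
  have "compact_symbol (\<lambda>z. u z - V z)"
  proof (rule compact_symbol_compact_support[where r = r and B = "B + B'"])
    show "(\<lambda>z. u z - V z) \<in> borel_measurable disc"
      using u(1) compact_symbol_measurable[OF cV] by auto
    show "norm (u z - V z) \<le> B + B'" if "z \<in> ball 0 1" for z
      using u(2)[OF that] B'[OF that] norm_triangle_ineq4[of "u z" "V z"] by linarith
    show "u z - V z = 0" if "z \<in> ball 0 1" "r < norm z" for z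
      using that eq[of z] V(2)[of z] by auto
  qed (rule r)
  from compact_symbol_add[OF this cV] show ?thesis by simp
qed

section \<open>Angular symbols\<close>

lemma integrable_inverse_1_plus_square: "integrable lborel (\<lambda>t::real. 1 / (1 + t\<^sup>2))"
proof -
  have "set_integrable lborel (einterval (-\<infinity>) \<infinity>) (\<lambda>t::real. 1 / (1 + t\<^sup>2))"
  proof (rule interval_integral_FTC_nonneg)
    show "(arctan has_real_derivative 1 / (1 + x\<^sup>2)) (at x)" for x
      by (auto intro!: derivative_eq_intros simp: divide_inverse)
    show "isCont (\<lambda>t. 1 / (1 + t\<^sup>2)) x" for x :: real
      by (auto intro!: continuous_intros simp: add_nonneg_eq_0_iff)
    show "((arctan \<circ> real_of_ereal) \<longlongrightarrow> - (pi / 2)) (at_right (- \<infinity>))"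
      by (simp add: ereal_tendsto_simps tendsto_arctan_at_bot)
    show "((arctan \<circ> real_of_ereal) \<longlongrightarrow> pi / 2) (at_left \<infinity>)"
      by (simp add: ereal_tendsto_simps tendsto_arctan_at_top)
  qed auto
  then show ?thesis by (simp add: set_integrable_def)
qed

text \<open>The integral of exp(i q theta) over theta in (-pi/2, pi/2), with the removable
  singularity at q = 0 filled in.\<close>

definition angle_integral :: "real \<Rightarrow> real" where
  "angle_integral q = (if q = 0 then pi else 2 * sin (q * pi / 2) / q)"

text \<open>With t = tan theta the weight 1 / (1 + t^2) becomes dtheta. The primitive
  \<open>F\<close> is written in t, and the limits of \<open>arctan\<close> at both ends supply the
  endpoints of the angle.\<close>

lemma integral_cis_arctan:
  "integrable lborel (\<lambda>t. cis (q * arctan t) /\<^sub>R (1 + t\<^sup>2))"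
  "(LINT t|lborel. cis (q * arctan t) /\<^sub>R (1 + t\<^sup>2)) = of_real (angle_integral q)"
proof -
  let ?f = "\<lambda>t. cis (q * arctan t) /\<^sub>R (1 + t\<^sup>2)"
  have ne: "1 + t\<^sup>2 \<noteq> 0" for t :: real by (simp add: add_nonneg_eq_0_iff)
  have cont: "isCont ?f t" for t
    unfolding cis_conv_exp using ne by (intro continuous_intros) auto
  show i: "integrable lborel ?f"
  proof (rule Bochner_Integration.integrable_bound[OF integrable_inverse_1_plus_square])
    have "continuous_on UNIV ?f" using cont by (simp add: continuous_at_imp_continuous_on)
    then show "?f \<in> borel_measurable lborel" by (simp add: borel_measurable_continuous_onI)
  qed (auto simp: divide_inverse)
  show "(LINT t|lborel. ?f t) = of_real (angle_integral q)"
  proof -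
    define F where "F t = (if q = 0 then of_real (arctan t) else cis (q * arctan t) / (\<i> * of_real q))" for t
    have "(LBINT t=-\<infinity>..\<infinity>. ?f t) = (if q = 0 then of_real (pi/2) else cis (q * (pi/2)) / (\<i> * of_real q))
        - (if q = 0 then of_real (- (pi/2)) else cis (q * (- (pi/2))) / (\<i> * of_real q))"
    proof (rule interval_integral_FTC_integrable[where F = F])
      show "(F has_vector_derivative ?f t) (at t)" for t
      proof (cases "q = 0")
        case True
        have "((\<lambda>t. complex_of_real (arctan t)) has_vector_derivative of_real (inverse (1 + t\<^sup>2))) (at t)"
          by (intro has_vector_derivative_of_real has_real_derivative_iff_has_vector_derivative[THEN iffD1])
            (auto intro!: derivative_eq_intros)
        then show ?thesis using True by (simp add: F_def[abs_def] scaleR_conv_of_real)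
      next
        case False
        have "((\<lambda>t. q * arctan t) has_real_derivative q * inverse (1 + t\<^sup>2)) (at t)"
          by (auto intro!: derivative_eq_intros)
        then have "((\<lambda>t. \<i> * of_real (q * arctan t)) has_vector_derivative \<i> * of_real (q * inverse (1 + t\<^sup>2))) (at t)"
          by (intro has_vector_derivative_mult_right has_vector_derivative_of_real
              has_real_derivative_iff_has_vector_derivative[THEN iffD1])
        then have "((\<lambda>t. exp (\<i> * of_real (q * arctan t))) has_vector_derivative
            \<i> * of_real (q * inverse (1 + t\<^sup>2)) * exp (\<i> * of_real (q * arctan t))) (at t)"
          using field_vector_diff_chain_at[OF _ DERIV_exp] by (auto simp: o_def)
        then have "((\<lambda>t. exp (\<i> * of_real (q * arctan t)) / (\<i> * of_real q)) has_vector_derivative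
            \<i> * of_real (q * inverse (1 + t\<^sup>2)) * exp (\<i> * of_real (q * arctan t)) / (\<i> * of_real q)) (at t)"
          by (rule has_vector_derivative_divide)
        moreover have "F = (\<lambda>t. exp (\<i> * of_real (q * arctan t)) / (\<i> * of_real q))"
          using False by (auto simp: F_def cis_conv_exp)
        moreover have "\<i> * of_real (q * inverse (1 + t\<^sup>2)) * exp (\<i> * of_real (q * arctan t)) / (\<i> * of_real q) = ?f t"
          using False by (simp add: cis_conv_exp scaleR_conv_of_real)
        ultimately show ?thesis by simp
      qed
      show "isCont ?f t" for t by (rule cont)
      show "set_integrable lborel (einterval (- \<infinity>) \<infinity>) ?f"
        using i by (simp add: set_integrable_def)
      have "(F \<longlongrightarrow> (if q = 0 then of_real (- (pi/2)) else cis (q * (- (pi/2))) / (\<i> * of_real q))) at_bot"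
      proof (cases "q = 0")
        case True
        have "((\<lambda>t. complex_of_real (arctan t)) \<longlongrightarrow> of_real (- (pi/2))) at_bot"
          using tendsto_arctan_at_bot by (intro tendsto_of_real) simp
        then show ?thesis using True by (simp add: F_def[abs_def])
      next
        case False
        have "((\<lambda>t. exp (\<i> * of_real (q * arctan t)) / (\<i> * of_real q)) \<longlongrightarrow>
            exp (\<i> * of_real (q * (- (pi/2)))) / (\<i> * of_real q)) at_bot"
          using False tendsto_arctan_at_bot by (intro tendsto_intros) simp_all
        then show ?thesis
          unfolding F_def[abs_def] cis_conv_exp using False by (simp only: if_False)
      qed
      then show "((F \<circ> real_of_ereal) \<longlongrightarrow> (if q = 0 then of_real (- (pi/2)) else cis (q * (- (pi/2))) / (\<i> * of_real q))) (at_right (-\<infinity>))"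
        by (simp add: ereal_tendsto_simps)
      have "(F \<longlongrightarrow> (if q = 0 then of_real (pi/2) else cis (q * (pi/2)) / (\<i> * of_real q))) at_top"
      proof (cases "q = 0")
        case True
        have "((\<lambda>t. complex_of_real (arctan t)) \<longlongrightarrow> of_real (pi/2)) at_top"
          using tendsto_arctan_at_top by (intro tendsto_of_real) simp
        then show ?thesis using True by (simp add: F_def[abs_def])
      next
        case False
        have "((\<lambda>t. exp (\<i> * of_real (q * arctan t)) / (\<i> * of_real q)) \<longlongrightarrow>
            exp (\<i> * of_real (q * (pi/2))) / (\<i> * of_real q)) at_top"
          using False tendsto_arctan_at_top by (intro tendsto_intros) simp_all
        then show ?thesis
          unfolding F_def[abs_def] cis_conv_exp using False by (simp only: if_False)
      qed
      then show "((F \<circ> real_of_ereal) \<longlongrightarrow> (if q = 0 then of_real (pi/2) else cis (q * (pi/2)) / (\<i> * of_real q))) (at_left \<infinity>)"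
        by (simp add: ereal_tendsto_simps)
    qed simp
    also have "\<dots> = of_real (angle_integral q)"
      by (auto simp: angle_integral_def complex_eq_iff Re_divide Im_divide power2_eq_square field_simps)
    finally show ?thesis by (simp add: interval_lebesgue_integral_def set_lebesgue_integral_def)
  qed
qed

text \<open>Moves the singular boundary point 1 to the origin, where the slope coordinates are
  centred.\<close>

lemma lborel_reflect:
  fixes G :: "complex \<Rightarrow> complex"
  assumes "integrable lborel G"
  shows "integrable lborel (\<lambda>w. G (1 - w))" "(LINT w|lborel. G (1 - w)) = (LINT z|lborel. G z)"
proof -
  have [measurable]: "G \<in> borel_measurable borel" using assms by auto
  have d: "distr lborel borel (\<lambda>w. 1 - w) = (lborel :: complex measure)"
    using lborel_affine[of "-1" "1::complex"] by (simp add: density_1)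
  show "integrable lborel (\<lambda>w. G (1 - w))"
    using assms by (subst (asm) d[symmetric], subst (asm) integrable_distr_eq) auto
  show "(LINT w|lborel. G (1 - w)) = (LINT z|lborel. G z)"
    by (subst (2) d[symmetric], subst integral_distr) auto
qed

section \<open>Ray integrals and the moments of an angular symbol\<close>

lemma one_minus_disc: "z \<in> ball 0 1 \<Longrightarrow> Re (1 - z) > 0"
  using abs_Re_le_cmod[of z] by auto

lemma integral_ray:
  fixes c :: complex and X :: real
  assumes c: "c \<noteq> 0" and X: "X \<ge> 0"
  shows "(LINT x|lborel. indicator {0..X} x *\<^sub>R (of_real x * (1 - of_real x * c) ^ m))
    = ((1 - of_real X * c) ^ (m + 2) / of_nat (m + 2) - (1 - of_real X * c) ^ (m + 1) / of_nat (m + 1)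
       + 1 / (of_nat (m + 1) * of_nat (m + 2))) / c\<^sup>2"
proof -
  \<comment> \<open>With y = 1 - x c one has x y^m = (y^m - y^(m+1)) / c and dx = -dy / c, which
    gives this primitive. Its value at 0 produces the term independent of the upper end.\<close>
  define G where "G x = ((1 - x * c) ^ (m + 2) / of_nat (m + 2) - (1 - x * c) ^ (m + 1) / of_nat (m + 1)) / c\<^sup>2" for x
  have n: "of_nat (m + 1) \<noteq> (0::complex)" "of_nat (m + 2) \<noteq> (0::complex)"
    by (simp_all only: of_nat_eq_0_iff)
  have G': "(G has_field_derivative x * (1 - x * c) ^ m) (at x)" for x
    unfolding G_def[abs_def]
  proof -
    have p: "((\<lambda>x. (1 - x * c) ^ Suc j / of_nat (Suc j)) has_field_derivative (- c) * (1 - x * c) ^ j) (at x)" for j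
      by (rule derivative_eq_intros refl | simp del: of_nat_Suc)+
    have "((\<lambda>x. ((1 - x * c) ^ (m + 2) / of_nat (m + 2) - (1 - x * c) ^ (m + 1) / of_nat (m + 1)) / c\<^sup>2)
      has_field_derivative ((- c) * (1 - x * c) ^ (m + 1) - (- c) * (1 - x * c) ^ m) / c\<^sup>2) (at x)"
      using p[of "m + 1"] p[of m] by (intro DERIV_cdivide DERIV_diff) simp_all
    also have "((- c) * (1 - x * c) ^ (m + 1) - (- c) * (1 - x * c) ^ m) / c\<^sup>2 = x * (1 - x * c) ^ m"
      using c by (simp add: field_simps power2_eq_square)
    finally show "((\<lambda>x. ((1 - x * c) ^ (m + 2) / of_nat (m + 2) - (1 - x * c) ^ (m + 1) / of_nat (m + 1)) / c\<^sup>2)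
      has_field_derivative x * (1 - x * c) ^ m) (at x)" .
  qed
  have "(LINT x|lborel. indicator {0..X} x *\<^sub>R (of_real x * (1 - of_real x * c) ^ m)) = G (of_real X) - G (of_real 0)"
  proof (rule integral_FTC_Icc[OF X])
    show "((\<lambda>x. G (of_real x)) has_vector_derivative of_real x * (1 - of_real x * c) ^ m) (at x within {0..X})" for x
      using has_vector_derivative_real_field[OF has_field_derivative_at_within[OF G'], of x "{0..X}"]
      by (simp add: has_vector_derivative_real_field[OF G'] has_vector_derivative_at_within)
  qed (intro continuous_intros)
  also have "\<dots> = ((1 - of_real X * c) ^ (m + 2) / of_nat (m + 2) - (1 - of_real X * c) ^ (m + 1) / of_nat (m + 1)
       + (1 / of_nat (m + 1) - 1 / of_nat (m + 2))) / c\<^sup>2"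
    by (simp add: G_def diff_divide_distrib add_divide_distrib)
  also have "1 / of_nat (m + 1) - 1 / of_nat (m + 2) = 1 / (of_nat (m + 1) * of_nat (m + 2) :: complex)"
    using n by (simp add: field_simps)
  finally show ?thesis .
qed

text \<open>This is \<open>cnj (sgn (w powr b))\<close> for w \<noteq> 0; the form through
  \<open>Arg\<close> has modulus 1 at 0 as well.\<close>

definition phase :: "real \<Rightarrow> complex \<Rightarrow> complex" where
  "phase b w = cis (- b * Arg w)"

text \<open>The average over all directions of \<open>phase b\<close> times \<open>phase 2\<close>.
  The frequency there is -(b + 2); the sign disappears because \<open>angle_integral\<close> is
  even.\<close>

definition phase_defect :: "real \<Rightarrow> real" where
  "phase_defect b = angle_integral (b + 2) / pi"

text \<open>The factor makes the average of \<open>phase_symbol b\<close> against \<open>phase 2\<close> over all directions vanish. This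
  removes the leading term of the moments below, which is of order \<open>m\<^sup>-\<^sup>2\<close> and would not be summable
  after multiplication by \<open>m\<close>.\<close>

definition phase_symbol :: "real \<Rightarrow> complex \<Rightarrow> complex" where
  "phase_symbol b z = phase b (1 - z) - of_real (phase_defect b) * phase (-2) (1 - z)"

lemma norm_phase [simp]: "norm (phase b w) = 1"
  by (simp add: phase_def)

lemma continuous_on_phase: "continuous_on {w. Re w > 0} (phase b)"
proof -
  have "continuous_on {w. Re w > 0} (\<lambda>w. cis (- b * Im (Ln w)))"
    unfolding cis_conv_exp
    by (intro continuous_intros) (auto simp: complex_nonpos_Reals_iff)
  moreover have "phase b w = cis (- b * Im (Ln w))" if "w \<in> {w. Re w > 0}" for w
    using that unfolding phase_def by (subst Arg_eq_Im_Ln) auto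
  ultimately show ?thesis using continuous_on_cong by (metis (no_types, lifting))
qed

lemma phase_symbol_measurable: "phase_symbol b \<in> borel_measurable disc"
  unfolding phase_symbol_def[abs_def]
  by (intro continuous_on_imp_measurable_disc continuous_intros
      continuous_on_compose2[OF continuous_on_phase]) (auto simp: one_minus_disc[simplified])

lemma norm_phase_symbol: "norm (phase_symbol b z) \<le> 1 + \<bar>phase_defect b\<bar>"
  unfolding phase_symbol_def by (rule order_trans[OF norm_triangle_ineq4]) (simp add: norm_mult)

lemma phase_ray:
  assumes "x > 0" shows "phase b (Complex x (x * t)) = cis (- b * arctan t)"
  using assms by (simp add: phase_def arg_conv_arctan)

lemma arctan_cis: "Complex 1 t / Complex 1 (-t) = cis (2 * arctan t)"
  "1 / (Complex 1 t)\<^sup>2 = cis (- 2 * arctan t) /\<^sub>R (1 + t\<^sup>2)"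
proof -
  define r where "r = sqrt (1 + t\<^sup>2)"
  have r: "r > 0" "r\<^sup>2 = 1 + t\<^sup>2" by (auto simp: r_def add_pos_nonneg)
  have 1: "Complex 1 t = of_real r * cis (arctan t)"
    using r by (simp add: complex_eq_iff cos_arctan sin_arctan r_def[symmetric])
  have 2: "Complex 1 (- t) = of_real r * cis (- arctan t)"
    using r by (simp add: complex_eq_iff cos_arctan sin_arctan r_def[symmetric])
  show "Complex 1 t / Complex 1 (-t) = cis (2 * arctan t)"
    unfolding 1 2 using r by (simp add: cis_divide)
  show "1 / (Complex 1 t)\<^sup>2 = cis (- 2 * arctan t) /\<^sub>R (1 + t\<^sup>2)"
    unfolding 1 power_mult_distrib r(2)[symmetric] using r(1)
    by (simp add: Complex.DeMoivre scaleR_conv_of_real divide_inverse cis_inverse)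
qed

text \<open>\<open>X\<close> is where the ray 1 - x (1 + i t) leaves the disc. The exit point is -(1
  + i t) / (1 - i t) = -exp(2 i theta), so the boundary terms of the primitive are pure oscillations
  in theta.\<close>

lemma integral_ray_phase:
  fixes t :: real
  defines "X \<equiv> 2 / (1 + t\<^sup>2)"
  shows "(LINT x|lborel. indicator {0..X} x *\<^sub>R (of_real x * (1 - of_real x * Complex 1 t) ^ m))
    = ((-1) ^ m * cis (2 * real (m + 1) * arctan t) / of_nat (m + 2) + (-1) ^ m * cis (2 * real m * arctan t) / of_nat (m + 1)
       + cis (- 2 * arctan t) / (of_nat (m + 1) * of_nat (m + 2))) /\<^sub>R (1 + t\<^sup>2)"
proof -
  have p: "1 + t\<^sup>2 > 0" by (simp add: add_pos_nonneg)
  have nz: "Complex 1 t \<noteq> 0" "Complex 1 (-t) \<noteq> 0" by (auto simp: complex_eq_iff)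
  have cc: "Complex 1 t * Complex 1 (-t) = of_real (1 + t\<^sup>2)"
    by (simp add: complex_eq_iff power2_eq_square)
  have "of_real X = 2 / (Complex 1 t * Complex 1 (-t))"
    unfolding cc X_def by simp
  then have "of_real X * Complex 1 t = 2 / Complex 1 (-t)"
    using nz by simp
  then have z: "1 - of_real X * Complex 1 t = - (Complex 1 t / Complex 1 (-t))"
    using nz by (simp add: field_simps) (simp add: complex_eq_iff)
  have pw: "(- (Complex 1 t / Complex 1 (-t))) ^ j = (-1) ^ j * cis (2 * real j * arctan t)" for j
    unfolding arctan_cis(1) by (subst power_minus) (simp add: Complex.DeMoivre mult_ac)
  have X: "X \<ge> 0" using p by (simp add: X_def)
  have "(LINT x|lborel. indicator {0..X} x *\<^sub>R (of_real x * (1 - of_real x * Complex 1 t) ^ m))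
    = ((-1) ^ (m + 2) * cis (2 * real (m + 2) * arctan t) / of_nat (m + 2) - (-1) ^ (m + 1) * cis (2 * real (m + 1) * arctan t) / of_nat (m + 1)
       + 1 / (of_nat (m + 1) * of_nat (m + 2))) * (1 / (Complex 1 t)\<^sup>2)"
    unfolding integral_ray[OF nz(1) X] z pw by (rule divide_inverse[unfolded inverse_eq_divide])
  also have "\<dots> = ((-1) ^ m * (cis (2 * real (m + 2) * arctan t) * cis (- 2 * arctan t)) / of_nat (m + 2)
       + (-1) ^ m * (cis (2 * real (m + 1) * arctan t) * cis (- 2 * arctan t)) / of_nat (m + 1)
       + cis (- 2 * arctan t) / (of_nat (m + 1) * of_nat (m + 2))) /\<^sub>R (1 + t\<^sup>2)"
  proof -
    have "((-1) ^ (m + 2) * A / a - (-1) ^ (m + 1) * B / a' + 1 / a'') * (e /\<^sub>R r)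
      = ((-1) ^ m * (A * e) / a + (-1) ^ m * (B * e) / a' + e / a'') /\<^sub>R r" for A B a a' a'' e :: complex and r :: real
      by (simp add: distrib_right mult.assoc)
    then show ?thesis unfolding arctan_cis(2) .
  qed
  also have "cis (2 * real (m + 2) * arctan t) * cis (- 2 * arctan t) = cis (2 * real (m + 1) * arctan t)"
    unfolding cis_mult by (rule arg_cong[of _ _ cis]) (simp add: algebra_simps)
  also have "cis (2 * real (m + 1) * arctan t) * cis (- 2 * arctan t) = cis (2 * real m * arctan t)"
    unfolding cis_mult by (rule arg_cong[of _ _ cis]) (simp add: algebra_simps)
  finally show ?thesis .
qed


lemma ray_in_disc_iff:
  assumes "x > 0"
  shows "1 - Complex x (x * t) \<in> ball 0 1 \<longleftrightarrow> x < 2 / (1 + t\<^sup>2)"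
proof -
  have p: "1 + t\<^sup>2 > 0" by (simp add: add_pos_nonneg)
  have "1 - Complex x (x * t) \<in> ball 0 1 \<longleftrightarrow> (norm (1 - Complex x (x * t)))\<^sup>2 < 1\<^sup>2"
    by (simp add: abs_square_less_1)
  also have "(norm (1 - Complex x (x * t)))\<^sup>2 = 1 - x * (2 - x * (1 + t\<^sup>2))"
    unfolding cmod_power2 by (simp add: power2_eq_square algebra_simps)
  also have "1 - x * (2 - x * (1 + t\<^sup>2)) < 1\<^sup>2 \<longleftrightarrow> x * (1 + t\<^sup>2) < 2"
    using assms by (simp add: zero_less_mult_iff)
  finally show ?thesis using p by (simp add: field_simps)
qed

text \<open>The symbol is constant on each ray from 1, so it factors out of the inner integral as
  \<open>P t\<close>. Multiplication by \<open>P t\<close> shifts each frequency q of the ray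
  integral to q - b and to q + 2, and integration over t turns every frequency into an
  \<open>angle_integral\<close>.\<close>

lemma phase_symbol_moment_integral:
  "(LINT z|disc. z ^ m * phase_symbol b z) = of_real (
     (-1) ^ m * (angle_integral (2 * real (m + 1) - b) - phase_defect b * angle_integral (2 * real (m + 2))) / real (m + 2)
     + (-1) ^ m * (angle_integral (2 * real m - b) - phase_defect b * angle_integral (2 * real (m + 1))) / real (m + 1)
     + (angle_integral (- b - 2) - phase_defect b * angle_integral 0) / (real (m + 1) * real (m + 2)))"
proof -
  define l where "l = complex_of_real (phase_defect b)"
  define G where "G z = indicator (ball 0 1) z *\<^sub>R (z ^ m * phase_symbol b z)" for z
  define P where "P t = cis (- b * arctan t) - l * cis (2 * arctan t)" for t
  define h where "h q t = cis (q * arctan t) /\<^sub>R (1 + t\<^sup>2)" for q t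
  have "integrable disc (\<lambda>z. z ^ m * phase_symbol b z)"
  proof (rule integrable_disc_bounded)
    show "(\<lambda>z. z ^ m * phase_symbol b z) \<in> borel_measurable disc"
      by (intro borel_measurable_times phase_symbol_measurable continuous_on_imp_measurable_disc[of "\<lambda>z. z ^ m"] continuous_intros)
    show "norm (z ^ m * phase_symbol b z) \<le> 1 * (1 + \<bar>phase_defect b\<bar>)" if "z \<in> ball 0 1" for z
      unfolding norm_mult norm_power using that
      by (intro mult_mono norm_phase_symbol power_le_one) auto
  qed
  then have iG: "integrable lborel G"
    by (simp add: integrable_disc set_integrable_def G_def[abs_def])
  have "(LINT z|disc. z ^ m * phase_symbol b z) = (LINT w|lborel. G (1 - w))"
    unfolding lborel_reflect(2)[OF iG] by (simp add: integral_disc set_lebesgue_integral_def G_def[abs_def])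
  also have "\<dots> = (LINT t|lborel. LINT x|lborel. \<bar>x\<bar> *\<^sub>R G (1 - Complex x (x * t)))"
    by (rule integral_slope_coordinates[OF lborel_reflect(1)[OF iG]])
  also have "(\<lambda>t. LINT x|lborel. \<bar>x\<bar> *\<^sub>R G (1 - Complex x (x * t)))
     = (\<lambda>t. P t * (((-1) ^ m * cis (2 * real (m + 1) * arctan t) / of_nat (m + 2) + (-1) ^ m * cis (2 * real m * arctan t) / of_nat (m + 1)
       + cis (- 2 * arctan t) / (of_nat (m + 1) * of_nat (m + 2))) /\<^sub>R (1 + t\<^sup>2)))"
  proof
    fix t :: real
    define X where "X = 2 / (1 + t\<^sup>2)"
    have "(LINT x|lborel. \<bar>x\<bar> *\<^sub>R G (1 - Complex x (x * t)))
        = (LINT x|lborel. P t * (indicator {0..X} x *\<^sub>R (of_real x * (1 - of_real x * Complex 1 t) ^ m)))"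
    \<comment> \<open>The endpoint \<open>X\<close> belongs to the closed interval, but the exit
      point is not in the open disc; this single value of x is discarded.\<close>
    proof (rule integral_discrete_difference[where X = "{X}"])
      fix x assume x: "x \<notin> {X}"
      have C: "of_real x * Complex 1 t = Complex x (x * t)" by (simp add: complex_eq_iff)
      consider "x < 0" | "x = 0" | "x > 0" by linarith
      then show "\<bar>x\<bar> *\<^sub>R G (1 - Complex x (x * t)) = P t * (indicator {0..X} x *\<^sub>R (of_real x * (1 - of_real x * Complex 1 t) ^ m))"
      proof cases
        case 1
        then have "1 - Complex x (x * t) \<notin> ball 0 1"
          using one_minus_disc[of "1 - Complex x (x * t)"] by auto
        then show ?thesis using 1 by (simp add: G_def)
      next
        case 2
        then show ?thesis by simp
      next
        case 3
        have "phase_symbol b (1 - Complex x (x * t)) = P t"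
          by (simp add: phase_symbol_def phase_ray[OF 3] P_def l_def)
        then show ?thesis
          using 3 x ray_in_disc_iff[OF 3, of t]
          by (auto simp: G_def C X_def[symmetric] indicator_def scaleR_conv_of_real)
      qed
    qed auto
    also have "\<dots> = P t * (LINT x|lborel. (indicator {0..X} x *\<^sub>R (of_real x * (1 - of_real x * Complex 1 t) ^ m)))"
      by (rule integral_mult_right_zero)
    finally show "(LINT x|lborel. \<bar>x\<bar> *\<^sub>R G (1 - Complex x (x * t))) = P t * (((-1) ^ m * cis (2 * real (m + 1) * arctan t) / of_nat (m + 2) + (-1) ^ m * cis (2 * real m * arctan t) / of_nat (m + 1)
       + cis (- 2 * arctan t) / (of_nat (m + 1) * of_nat (m + 2))) /\<^sub>R (1 + t\<^sup>2))"
      unfolding X_def integral_ray_phase .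
  qed
  also have "\<dots> = (\<lambda>t. (-1) ^ m / of_nat (m + 2) * (h (2 * real (m + 1) - b) t - l * h (2 * real (m + 2)) t)
      + (-1) ^ m / of_nat (m + 1) * (h (2 * real m - b) t - l * h (2 * real (m + 1)) t)
      + 1 / (of_nat (m + 1) * of_nat (m + 2)) * (h (- b - 2) t - l * h 0 t))"
  proof
    fix t :: real
    have c: "P t * cis (q * arctan t) = cis ((q - b) * arctan t) - l * cis ((q + 2) * arctan t)" for q
      by (simp add: P_def algebra_simps cis_mult)
    have d: "P t * (cis (q * arctan t) /\<^sub>R (1 + t\<^sup>2)) = h (q - b) t - l * h (q + 2) t" for q
    proof -
      have "P t * (cis (q * arctan t) /\<^sub>R (1 + t\<^sup>2)) = (P t * cis (q * arctan t)) /\<^sub>R (1 + t\<^sup>2)" by simp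
      then show ?thesis unfolding c h_def by (simp add: scaleR_right_diff_distrib)
    qed
    have "P t * ((x * cis (q * arctan t) / a + x * cis (q' * arctan t) / a'
       + cis (q'' * arctan t) / a'') /\<^sub>R (1 + t\<^sup>2))
      = x / a * (P t * (cis (q * arctan t) /\<^sub>R (1 + t\<^sup>2))) + x / a' * (P t * (cis (q' * arctan t) /\<^sub>R (1 + t\<^sup>2)))
       + 1 / a'' * (P t * (cis (q'' * arctan t) /\<^sub>R (1 + t\<^sup>2)))" for x a a' a'' q q' q''
      by (simp add: scaleR_add_right distrib_left mult.left_commute[of "P t"])
    note e = this[of "(-1) ^ m" "2 * real (m + 1)" "of_nat (m + 2)" "2 * real m" "of_nat (m + 1)" "-2" "of_nat (m + 1) * of_nat (m + 2)"]
    have q: "2 * real (m + 1) + 2 = 2 * real (m + 2)" "2 * real m + 2 = 2 * real (m + 1)" "- 2 + 2 = (0::real)" "- 2 - b = - b - 2" by auto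
    show "P t * (((-1) ^ m * cis (2 * real (m + 1) * arctan t) / of_nat (m + 2) + (-1) ^ m * cis (2 * real m * arctan t) / of_nat (m + 1)
       + cis (- 2 * arctan t) / (of_nat (m + 1) * of_nat (m + 2))) /\<^sub>R (1 + t\<^sup>2)) =
      (-1) ^ m / of_nat (m + 2) * (h (2 * real (m + 1) - b) t - l * h (2 * real (m + 2)) t)
      + (-1) ^ m / of_nat (m + 1) * (h (2 * real m - b) t - l * h (2 * real (m + 1)) t)
      + 1 / (of_nat (m + 1) * of_nat (m + 2)) * (h (- b - 2) t - l * h 0 t)"
      unfolding e d q ..
  qed
  also have "(LINT t|lborel. (-1) ^ m / of_nat (m + 2) * (h (2 * real (m + 1) - b) t - l * h (2 * real (m + 2)) t)
      + (-1) ^ m / of_nat (m + 1) * (h (2 * real m - b) t - l * h (2 * real (m + 1)) t)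
      + 1 / (of_nat (m + 1) * of_nat (m + 2)) * (h (- b - 2) t - l * h 0 t))
    = (-1) ^ m / of_nat (m + 2) * (of_real (angle_integral (2 * real (m + 1) - b)) - l * of_real (angle_integral (2 * real (m + 2))))
      + (-1) ^ m / of_nat (m + 1) * (of_real (angle_integral (2 * real m - b)) - l * of_real (angle_integral (2 * real (m + 1))))
      + 1 / (of_nat (m + 1) * of_nat (m + 2)) * (of_real (angle_integral (- b - 2)) - l * of_real (angle_integral 0))"
  proof -
    have i: "integrable lborel (h q)" and v: "(LINT t|lborel. h q t) = of_real (angle_integral q)" for q
      using integral_cis_arctan[of q] by (auto simp: h_def[abs_def])
    have ii: "integrable lborel (\<lambda>t. c * (h q t - l * h q' t))"
      and vv: "(LINT t|lborel. c * (h q t - l * h q' t)) = c * (of_real (angle_integral q) - l * of_real (angle_integral q'))" for c q q'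
      using i[of q] i[of q'] by (simp_all add: v)
    show ?thesis by (simp only: ii vv Bochner_Integration.integral_add Bochner_Integration.integrable_add)
  qed
  finally show ?thesis by (simp add: l_def)
qed

lemma angle_integral_even: "j > 0 \<Longrightarrow> angle_integral (2 * real j) = 0"
  by (simp add: angle_integral_def sin_npi)

lemma angle_integral_shift:
  assumes "2 * real j - b - 2 \<noteq> 0"
  shows "angle_integral (2 * real j - b - 2) = - 2 * (-1) ^ j * sin ((b + 2) * pi / 2) / (2 * real j - b - 2)"
proof -
  have "sin ((2 * real j - b - 2) * pi / 2) = sin (real j * pi - (b + 2) * pi / 2)"
    by (simp add: field_simps)
  also have "\<dots> = - ((-1) ^ j * sin ((b + 2) * pi / 2))"
    by (simp add: sin_diff cos_npi sin_npi)
  finally show ?thesis using assms by (simp add: angle_integral_def)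
qed

text \<open>The correction enters the exit terms only through nonzero even frequencies, whose
  angular integrals vanish. What remains there is a difference of consecutive values of one sequence
  of order m^(-2), hence of order m^(-3). The hypothesis keeps the denominators positive.\<close>

lemma phase_symbol_moment:
  assumes "2 * real (m + 1) - b - 2 > 0"
  shows "(LINT z|disc. z ^ m * phase_symbol b z) = of_real (2 * sin ((b + 2) * pi / 2) *
     (1 / (real (m + 1) * (2 * real (m + 1) - b - 2)) - 1 / (real (m + 2) * (2 * real (m + 2) - b - 2))))"
proof -
  have 1: "angle_integral (2 * real (m + 1) - b) = - 2 * (-1) ^ m * sin ((b + 2) * pi / 2) / (2 * real (m + 2) - b - 2)"
    using angle_integral_shift[of "m + 2" b] assms by (simp add: algebra_simps)
  have 2: "angle_integral (2 * real m - b) = 2 * (-1) ^ m * sin ((b + 2) * pi / 2) / (2 * real (m + 1) - b - 2)"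
    using angle_integral_shift[of "m + 1" b] assms by (simp add: algebra_simps)
  \<comment> \<open>The choice of \<open>phase_defect\<close> is made for this cancellation: it
    removes the term of exact order m^(-2).\<close>
  have 3: "angle_integral (- b - 2) = phase_defect b * angle_integral 0"
  proof -
    have "(- b - 2) * pi / 2 = - ((b + 2) * pi / 2)" by (simp add: field_simps)
    then have "sin ((- b - 2) * pi / 2) = - sin ((b + 2) * pi / 2)" by (simp only: sin_minus)
    moreover have "x / (- b - 2) = - (x / (b + 2))" for x
      using minus_divide_right[of x "b + 2"] by simp
    ultimately show ?thesis by (simp add: phase_defect_def angle_integral_def)
  qed
  have e: "angle_integral (2 * real (m + 2)) = 0" "angle_integral (2 * real (m + 1)) = 0"
    by (simp_all only: angle_integral_even add_gr_0 zero_less_one zero_less_numeral simp_thms)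
  have alg: "s * (- 2 * s * c / x - d * 0) / y + s * (2 * s * c / x' - d * 0) / y' + (e - e) / w
      = 2 * c * (1 / (y' * x') - 1 / (y * x))" if "s * s = 1" for s c x x' y y' d e w :: real
  proof -
    have "s * (- 2 * s * c / x - d * 0) / y + s * (2 * s * c / x' - d * 0) / y' + (e - e) / w
      = (s * s) * (2 * c * (1 / (y' * x') - 1 / (y * x)))"
      by (simp add: right_diff_distrib mult.assoc mult.left_commute mult.commute)
    then show ?thesis using that by simp
  qed
  have s: "(-1) ^ m * (-1) ^ m = (1::real)" by (simp add: power_mult_distrib[symmetric])
  show ?thesis
    unfolding phase_symbol_moment_integral 1 2 3 e by (simp only: alg[OF s])
qed

lemma summable_phase_symbol_moments:
  "summable (\<lambda>m. real (m + 1) * norm (LINT z|disc. z ^ m * phase_symbol b z))"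
proof (rule summable_comparison_test_ev)
  \<comment> \<open>This is m + 1 times the difference of reciprocals in the moment formula, brought
    to a common denominator.\<close>
  let ?g = "\<lambda>m. (4 * real m + 4 - b) / ((2 * real m - b) * (real m + 2) * (2 * real m + 2 - b))"
  have "?g \<in> O(\<lambda>m. 1 / real m ^ 2)" by real_asymp
  moreover have "summable (\<lambda>m. norm (1 / real m ^ 2))"
    using inverse_power_summable[of 2, where 'a = real] by (simp add: divide_inverse)
  ultimately have "summable ?g"
    by (rule summable_comparison_test_bigo[rotated])
  then show "summable (\<lambda>m. \<bar>2 * sin ((b + 2) * pi / 2)\<bar> * ?g m)" by (rule summable_mult)
  have "\<forall>\<^sub>F m in sequentially. 2 * real m - b > 0" by real_asymp
  then show "\<forall>\<^sub>F m in sequentially. norm (real (m + 1) * norm (LINT z|disc. z ^ m * phase_symbol b z))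
      \<le> \<bar>2 * sin ((b + 2) * pi / 2)\<bar> * ?g m"
  proof eventually_elim
    case (elim m)
    define u where "u = 2 * real m - b"
    define c where "c = 2 * sin ((b + 2) * pi / 2)"
    have u: "u > 0" using elim by (simp add: u_def)
    have d: "1 / (real (m + 1) * u) - 1 / (real (m + 2) * (u + 2)) = ?g m / real (m + 1)"
    proof -
      have "1 / (M * u) - 1 / ((M + 1) * (u + 2)) = (u + 2 * M + 2) / (u * (M + 1) * (u + 2)) / M"
        if "M > 0" for M :: real
      proof -
        have "1 / (M * u) - 1 / ((M + 1) * (u + 2)) = ((M + 1) * (u + 2) - M * u) / (M * u * ((M + 1) * (u + 2)))"
          using u that by (subst diff_frac_eq) auto
        also have "(M + 1) * (u + 2) - M * u = u + 2 * M + 2" by (simp add: algebra_simps)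
        finally show ?thesis by (simp add: mult_ac)
      qed
      from this[of "real (m + 1)"] show ?thesis by (simp add: u_def algebra_simps)
    qed
    have g: "?g m \<ge> 0"
      using elim by (intro divide_nonneg_nonneg mult_nonneg_nonneg) auto
    have "(LINT z|disc. z ^ m * phase_symbol b z)
        = of_real (c * (1 / (real (m + 1) * u) - 1 / (real (m + 2) * (u + 2))))"
    proof -
      have "2 * real (m + 1) - b - 2 = u" "2 * real (m + 2) - b - 2 = u + 2" by (simp_all add: u_def)
      then show ?thesis using phase_symbol_moment[of m b] u unfolding c_def by (simp only:)
    qed
    then have "norm (LINT z|disc. z ^ m * phase_symbol b z) = \<bar>c\<bar> * (?g m / real (m + 1))"
      by (simp only: d norm_of_real abs_mult abs_divide[of _ "real (m + 1)"] abs_of_nonneg[OF g] abs_of_nat)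
    then have "norm (real (m + 1) * norm (LINT z|disc. z ^ m * phase_symbol b z)) = \<bar>c\<bar> * ?g m"
      by (simp only: real_norm_def abs_mult abs_abs abs_of_nonneg[OF g] abs_of_nat abs_divide[of _ "real (m + 1)"]) simp
    then show ?case by (simp only: c_def)
  qed
qed

text \<open>A rotation multiplies each moment by a number of modulus 1, so the summability test
  carries over.\<close>

lemma compact_symbol_rotate:
  assumes u: "u \<in> borel_measurable disc" "\<And>z. z \<in> ball 0 1 \<Longrightarrow> norm (u z) \<le> B"
    and S: "summable (\<lambda>m. real (m + 1) * norm (LINT z|disc. z ^ m * u z))" and a: "norm a = 1"
  shows "compact_symbol (\<lambda>z. u (a * z))"
proof (rule compact_symbol_summable)
  show "(\<lambda>z. u (a * z)) \<in> borel_measurable disc" by (rule integral_disc_rotate(2)[OF u(1) a])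
  show "norm (u (a * z)) \<le> B" if "z \<in> ball 0 1" for z using that a by (intro u) (simp add: norm_mult)
  have "norm (LINT z|disc. z ^ m * u (a * z)) = norm (LINT z|disc. z ^ m * u z)" for m
  proof -
    have "(\<lambda>z. z ^ m * u z) \<in> borel_measurable disc"
      by (intro borel_measurable_times u(1) continuous_on_imp_measurable_disc[of "\<lambda>z. z ^ m"] continuous_intros)
    from integral_disc_rotate(1)[OF this a]
    have "(LINT z|disc. z ^ m * u z) = (LINT z|disc. a ^ m * (z ^ m * u (a * z)))"
      by (simp add: power_mult_distrib mult.assoc)
    also have "\<dots> = a ^ m * (LINT z|disc. z ^ m * u (a * z))" by simp
    finally show ?thesis using a by (simp add: norm_mult norm_power)
  qed
  then show "summable (\<lambda>m. real (m + 1) * norm (LINT z|disc. z ^ m * u (a * z)))" using S by simp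
qed

text \<open>With x = (b + 2) pi / 2 the claim is |sin x| < x for x > 0. Up to 1 it follows from the
  mean value theorem, beyond 1 from |sin x| \<le> 1.\<close>

lemma phase_defect_less:
  assumes "b > -2"
  shows "\<bar>phase_defect b\<bar> < 1"
proof -
  define x where "x = (b + 2) * pi / 2"
  have x: "x > 0" using assms by (simp add: x_def)
  have "\<bar>sin x\<bar> < x"
  proof (cases "x \<le> 1")
    case True
    obtain y where y: "0 < y" "y < x" "sin x - sin 0 = (x - 0) * cos y"
      using MVT2[of 0 x sin cos] x by auto
    have "cos y < 1" using cos_monotone_0_pi[of 0 y] y True pi_gt3 by simp
    then have "sin x < x" using y x by simp
    moreover have "sin x > 0" using x True pi_gt3 by (intro sin_gt_zero) auto
    ultimately show ?thesis by simp
  next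
    case False
    then show ?thesis using abs_sin_le_one[of x] by linarith
  qed
  moreover have "phase_defect b = sin x / x"
    using assms by (simp add: phase_defect_def angle_integral_def x_def field_simps)
  ultimately show ?thesis using x by simp
qed

section \<open>A criterion for strong exposedness\<close>

lemma bergman1_diff: "f \<in> bergman1 \<Longrightarrow> g \<in> bergman1 \<Longrightarrow> (\<lambda>z. f z - g z) \<in> bergman1"
  by (auto simp: bergman1_iff intro!: holomorphic_intros)

lemma integral_norm_eq_bergman1_norm: "(LINT z|disc. norm (f z)) = pi * bergman1_norm f"
  by (simp add: bergman1_norm_eq)

lemma bergman1_norm_cong: "(\<And>z. z \<in> ball 0 1 \<Longrightarrow> f z = g z) \<Longrightarrow> bergman1_norm f = bergman1_norm g"
  unfolding bergman1_norm_eq by (intro arg_cong2[where f = "(/)"] Bochner_Integration.integral_cong) auto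

lemma bergman1_norm_diff_le:
  assumes "f \<in> bergman1" "g \<in> bergman1"
  shows "bergman1_norm (\<lambda>z. f z - g z) \<le> bergman1_norm f + bergman1_norm g"
proof -
  have i: "integrable disc f" "integrable disc g" using assms by (auto simp: bergman1_iff)
  have "(LINT z|disc. norm (f z - g z)) \<le> (LINT z|disc. norm (f z) + norm (g z))"
    using i by (intro integral_mono) (auto intro: norm_triangle_ineq4)
  then show ?thesis using i by (simp add: bergman1_norm_eq divide_right_mono flip: add_divide_distrib)
qed

text \<open>Fatou's lemma: the norm bound survives pointwise limits even if mass escapes to the
  boundary.\<close>

lemma bergman1_limit:
  assumes x: "\<And>n. x n \<in> bergman1" "\<And>n. bergman1_norm (x n) \<le> C"
    and g: "g holomorphic_on ball 0 1" and lim: "\<And>z. z \<in> ball 0 1 \<Longrightarrow> (\<lambda>n. x n z) \<longlonglongrightarrow> g z"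
  shows "g \<in> bergman1"
proof -
  have gm: "g \<in> borel_measurable disc"
    by (intro continuous_on_imp_measurable_disc holomorphic_on_imp_continuous_on g)
  have xi: "integrable disc (x n)" for n using x by (simp add: bergman1_iff)
  have "(\<integral>\<^sup>+z. norm (g z) \<partial>disc) = (\<integral>\<^sup>+z. liminf (\<lambda>n. ennreal (norm (x n z))) \<partial>disc)"
  proof (rule nn_integral_cong)
    fix z assume "z \<in> space disc"
    then have "(\<lambda>n. ennreal (norm (x n z))) \<longlonglongrightarrow> ennreal (norm (g z))"
      using lim by (intro tendsto_ennrealI tendsto_norm) auto
    from lim_imp_Liminf[OF _ this] show "ennreal (norm (g z)) = liminf (\<lambda>n. ennreal (norm (x n z)))"
      by simp
  qed
  also have "\<dots> \<le> liminf (\<lambda>n. \<integral>\<^sup>+z. norm (x n z) \<partial>disc)"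
    using xi by (intro nn_integral_liminf) auto
  also have "\<dots> \<le> liminf (\<lambda>n::nat. ennreal (pi * C))"
  proof (intro Liminf_mono always_eventually allI)
    fix n
    have "(\<integral>\<^sup>+z. norm (x n z) \<partial>disc) = ennreal (pi * bergman1_norm (x n))"
      using xi[of n] by (subst nn_integral_eq_integral) (auto simp: integral_norm_eq_bergman1_norm)
    also have "\<dots> \<le> ennreal (pi * C)" using x(2)[of n] by (intro ennreal_leI) auto
    finally show "(\<integral>\<^sup>+z. norm (x n z) \<partial>disc) \<le> ennreal (pi * C)" .
  qed
  also have "\<dots> = ennreal (pi * C)" by (simp add: Liminf_const)
  finally have "(\<integral>\<^sup>+z. norm (g z) \<partial>disc) < \<infinity>" by (rule order_le_less_trans) simp
  then show ?thesis using g gm by (simp add: bergman1_iff integrable_iff_bounded)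
qed

text \<open>By the open mapping theorem a nonconstant image contains a disc around each of its
  points, and a disc leaves the real line.\<close>

lemma real_holomorphic_constant:
  assumes h: "h holomorphic_on S" and S: "open S" "connected S" and r: "\<And>z. z \<in> S \<Longrightarrow> h z \<in> \<real>"
  shows "h constant_on S"
proof (rule ccontr)
  assume nc: "\<not> h constant_on S"
  have "open (h ` S)" by (rule open_mapping_thm[OF h S S(1) order_refl nc])
  moreover obtain z where z: "z \<in> S" using nc unfolding constant_on_def by auto
  ultimately obtain e where e: "e > 0" "ball (h z) e \<subseteq> h ` S"
    by (meson imageI openE)
  have "h z + \<i> * of_real (e / 2) \<in> ball (h z) e" using e by (simp add: dist_norm norm_mult)
  then have "h z + \<i> * of_real (e / 2) \<in> h ` S" using e(2) by (rule subsetD[rotated])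
  then have "h z + \<i> * of_real (e / 2) \<in> \<real>" using r by (elim imageE) simp
  then show False using r[OF z] e(1) by (simp add: complex_is_Real_iff)
qed

text \<open>Nonempty open sets are not null. Applied to the set where two continuous functions
  differ, this upgrades equality almost everywhere to equality everywhere.\<close>

lemma AE_disc_open_empty:
  assumes V: "open V" "V \<subseteq> ball 0 1" and ae: "AE z in disc. z \<notin> V"
  shows "V = {}"
proof -
  have "AE z in lborel. z \<in> ball 0 1 \<longrightarrow> z \<notin> V"
    using ae unfolding disc_def by (subst (asm) AE_restrict_space_iff) auto
  then have "AE z in lborel. z \<notin> V" by eventually_elim (use V in auto)
  then have "V \<in> null_sets lborel"
    using V by (subst (asm) AE_iff_null_sets[symmetric]) auto
  then have "negligible V" by (simp add: negligible_iff_null_sets null_sets_completionI)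
  then show ?thesis using open_not_negligible[OF V(1)] by blast
qed

lemma borel_measurable_cnj_sgn:
  assumes "f \<in> borel_measurable M"
  shows "(\<lambda>z. cnj (sgn (f z))) \<in> borel_measurable M"
proof -
  have "cnj \<in> borel_measurable borel"
    by (intro borel_measurable_continuous_onI continuous_intros)
  then show ?thesis using assms by measurable
qed

lemma cnj_sgn_mult: "cnj (sgn w) * w = of_real (norm w)" for w :: complex
proof (cases "w = 0")
  case False
  have "cnj w * w = of_real (norm w * norm w)"
    using complex_norm_square[of w] by (simp add: power2_eq_square mult.commute)
  then show ?thesis
    using False by (simp add: sgn_div_norm scaleR_conv_of_real field_simps)
qed simp

text \<open>Equality in the trivial bound for the integral forces
  \<open>cnj (sgn (f z)) * h z = norm (h z)\<close>, so h / f is real and nonnegative wherever f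
  \<noteq> 0. It is therefore constant on a small disc, the identity theorem extends h = c f to the
  whole disc, and equal norms give c = 1.\<close>

lemma bergman1_equality_case:
  assumes f: "f \<in> bergman1" "bergman1_norm f = 1" and h: "h \<in> bergman1" "bergman1_norm h = 1"
    and L: "(LINT z|disc. cnj (sgn (f z)) * h z) = of_real pi" and z: "z \<in> ball 0 1"
  shows "h z = f z"
proof -
  have hol: "f holomorphic_on ball 0 1" "h holomorphic_on ball 0 1" and i: "integrable disc f" "integrable disc h"
    using f h by (auto simp: bergman1_iff)
  have fm: "f \<in> borel_measurable disc" using i by auto
  have m: "(\<lambda>z. cnj (sgn (f z))) \<in> borel_measurable disc"
    by (rule borel_measurable_cnj_sgn[OF fm])
  have ip: "integrable disc (\<lambda>z. cnj (sgn (f z)) * h z)"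
    by (rule integral_norm_pairing_le(1)[OF m _ i(2), of 1]) (simp add: norm_sgn)
  let ?d = "\<lambda>z. norm (h z) - Re (cnj (sgn (f z)) * h z)"
  have nn: "?d z \<ge> 0" for z
    using complex_Re_le_cmod[of "cnj (sgn (f z)) * h z"] mult_right_mono[of "norm (sgn (f z))" 1 "norm (h z)"]
    by (simp add: norm_mult norm_sgn split: if_splits)
  have "(LINT z|disc. ?d z) = 0"
  proof -
    have "(LINT z|disc. ?d z) = (LINT z|disc. norm (h z)) - (LINT z|disc. Re (cnj (sgn (f z)) * h z))"
      by (intro Bochner_Integration.integral_diff integrable_norm integrable_Re i ip)
    also have "(LINT z|disc. Re (cnj (sgn (f z)) * h z)) = pi"
      unfolding integral_Re[OF ip] L by simp
    finally show ?thesis using h(2) by (simp add: integral_norm_eq_bergman1_norm)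
  qed
  moreover have "integrable disc ?d"
    by (intro Bochner_Integration.integrable_diff integrable_norm integrable_Re i ip)
  ultimately have ae: "AE z in disc. ?d z = 0"
    using nn integral_nonneg_eq_0_iff_AE[of disc ?d] by blast
  define U where "U = {z \<in> ball 0 1. f z \<noteq> 0}"
  have contf: "continuous_on (ball 0 1) f" and conth: "continuous_on (ball 0 1) h"
    using hol by (auto intro: holomorphic_on_imp_continuous_on)
  have oU: "open U"
  proof -
    have "U = ball 0 1 \<inter> f -` (- {0})" by (auto simp: U_def)
    moreover have "open (ball 0 1 \<inter> f -` (- {0}))"
      by (rule continuous_open_preimage[OF contf open_ball]) auto
    ultimately show ?thesis by simp
  qed
  have cd: "continuous_on U ?d"
    unfolding sgn_div_norm using contf conth
    by (intro continuous_intros) (auto simp: U_def intro: continuous_on_subset)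
  have "open (U \<inter> ?d -` (- {0}))"
    by (rule continuous_open_preimage[OF cd oU]) auto
  then have "U \<inter> ?d -` (- {0}) = {}"
    using ae by (intro AE_disc_open_empty) (auto simp: U_def elim: eventually_mono)
  then have d0: "Re (cnj (sgn (f z)) * h z) = norm (h z)" if "z \<in> U" for z using that by auto
  have q: "h z / f z = of_real (norm (h z) / norm (f z))" if z: "z \<in> U" for z
  proof -
    have n: "norm (cnj (sgn (f z)) * h z) = norm (h z)" using z by (simp add: U_def norm_mult norm_sgn)
    have "cnj (sgn (f z)) * h z = of_real (norm (h z))"
    proof (rule complex_eqI)
      show "Im (cnj (sgn (f z)) * h z) = Im (of_real (norm (h z)))"
        using d0[OF z] n cmod_power2[of "cnj (sgn (f z)) * h z"] by simp
    qed (use d0[OF z] in simp)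
    then have "sgn (f z) * cnj (sgn (f z)) * h z = sgn (f z) * of_real (norm (h z))" by (simp add: mult.assoc)
    moreover have "sgn (f z) * cnj (sgn (f z)) = 1"
      using z by (subst complex_norm_square[symmetric]) (simp add: U_def norm_sgn)
    ultimately have "h z = sgn (f z) * of_real (norm (h z))" by simp
    then have "h z / f z = sgn (f z) * of_real (norm (h z)) / f z" by simp
    also have "\<dots> = of_real (norm (h z) / norm (f z))"
      using z by (simp add: U_def sgn_div_norm scaleR_conv_of_real divide_inverse)
    finally show ?thesis .
  qed
  have "\<exists>w. w \<in> U"
  proof (rule ccontr)
    assume "\<nexists>w. w \<in> U"
    then have "bergman1_norm f = bergman1_norm (\<lambda>_. 0)" by (intro bergman1_norm_cong) (auto simp: U_def)
    then show False using f by (simp add: bergman1_norm_eq)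
  qed
  then obtain w e where w: "w \<in> U" "e > 0" "ball w e \<subseteq> U" using oU by (meson openE)
  have sub: "ball w e \<subseteq> ball 0 1" and nz: "\<And>z. z \<in> ball w e \<Longrightarrow> f z \<noteq> 0"
    using w(3) by (auto simp: U_def)
  have "(\<lambda>z. h z / f z) constant_on ball w e"
  proof (rule real_holomorphic_constant)
    show "(\<lambda>z. h z / f z) holomorphic_on ball w e"
      by (intro holomorphic_on_divide holomorphic_on_subset[OF hol(1) sub] holomorphic_on_subset[OF hol(2) sub] nz)
    show "h z / f z \<in> \<real>" if "z \<in> ball w e" for z
      using q[of z] that w(3) by (metis Reals_of_real subsetD)
  qed auto
  then obtain c where c: "\<And>z. z \<in> ball w e \<Longrightarrow> h z / f z = c" unfolding constant_on_def by blast
  have cr: "c = of_real (norm (h w) / norm (f w))" using c[of w] q[of w] w by auto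
  have eq: "h z = c * f z" if "z \<in> ball 0 1" for z
  proof (rule analytic_continuation_open[of "ball w e" "ball 0 1" h "\<lambda>z. c * f z"])
    show "h z = c * f z" if "z \<in> ball w e" for z using c[OF that] nz[OF that] by (simp add: field_simps)
  qed (use w(2) hol that sub in \<open>auto intro!: holomorphic_intros\<close>)
  have "1 = bergman1_norm (\<lambda>z. c * f z)" using h(2) bergman1_norm_cong[of h "\<lambda>z. c * f z"] eq by simp
  also have "\<dots> = norm c * bergman1_norm f" by (simp add: bergman1_norm_eq norm_mult)
  finally have "norm c = 1" using f by simp
  then have "norm (h w) / norm (f w) = 1" unfolding cr norm_of_real by (simp only: abs_divide abs_norm_cancel)
  then have "c = 1" unfolding cr by (simp only: of_real_1)
  then show ?thesis using eq[OF z] by simp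
qed

text \<open>A sequence in the unit ball splits into its limit and a part that escapes to the boundary. On
  the second part the symbol \<open>cnj (sgn f)\<close> acts like \<open>u\<close>, whose norm is too small to
  let the functional reach the value 1 there.\<close>

lemma strongly_exposed_bergman1I:
  assumes f: "f \<in> bergman1" "bergman1_norm f = 1"
    and u: "u \<in> borel_measurable disc" "\<And>z. z \<in> ball 0 1 \<Longrightarrow> norm (u z) \<le> q" "q < 1"
    and comp: "compact_symbol (\<lambda>z. cnj (sgn (f z)) - u z)"
  shows "strongly_exposed_bergman1 f"
proof -
  define \<phi> where "\<phi> z = cnj (sgn (f z))" for z
  \<comment> \<open>The division by \<open>pi\<close> restores the normalised area measure, so that
    \<open>L f\<close> is the norm of f.\<close>
  define L where "L k = (LINT z|disc. \<phi> z * k z) / of_real pi" for k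
  have q0: "q \<ge> 0" using u(2)[of 0] norm_ge_zero[of "u 0"] by (simp del: norm_ge_zero)
  have "f \<in> borel_measurable disc" using f by (auto simp: bergman1_iff)
  then have m: "\<phi> \<in> borel_measurable disc"
    unfolding \<phi>_def[abs_def] by (rule borel_measurable_cnj_sgn)
  have b: "norm (\<phi> z) \<le> 1" for z by (simp add: \<phi>_def norm_sgn)
  have ip: "integrable disc (\<lambda>z. \<phi> z * k z)" if "k \<in> bergman1" for k
    using that by (intro integral_norm_pairing_le(1)[OF m b]) (auto simp: bergman1_iff)
  have Lb: "norm (L k) \<le> bergman1_norm k" if "k \<in> bergman1" for k
  proof -
    have "norm (LINT z|disc. \<phi> z * k z) \<le> 1 * (LINT z|disc. norm (k z))"
      using that by (intro integral_norm_pairing_le(2)[OF m b]) (auto simp: bergman1_iff)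
    then show ?thesis by (simp add: L_def norm_divide bergman1_norm_eq divide_right_mono)
  qed
  have Ladd: "L (\<lambda>z. k z + k' z) = L k + L k'" if "k \<in> bergman1" "k' \<in> bergman1" for k k'
    using ip[OF that(1)] ip[OF that(2)] by (simp add: L_def distrib_left add_divide_distrib)
  have Ldiff: "L (\<lambda>z. k z - k' z) = L k - L k'" if "k \<in> bergman1" "k' \<in> bergman1" for k k'
    using ip[OF that(1)] ip[OF that(2)] by (simp add: L_def right_diff_distrib diff_divide_distrib)
  have dual: "in_dual bergman1 bergman1_norm L"
    unfolding in_dual_def
  proof (intro conjI ballI allI exI)
    show "L (\<lambda>z. k z + k' z) = L k + L k'" if "k \<in> bergman1" "k' \<in> bergman1" for k k' using Ladd that .
    show "L (\<lambda>z. a * k z) = a * L k" for a k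
      by (simp add: L_def mult.left_commute[of _ a])
    show "norm (L k) \<le> 1 * bergman1_norm k" if "k \<in> bergman1" for k using Lb[OF that] by simp
  qed
  have pf: "\<phi> z * f z = of_real (norm (f z))" for z
    unfolding \<phi>_def by (rule cnj_sgn_mult)
  have "L f = complex_of_real (LINT z|disc. norm (f z)) / of_real pi"
    unfolding L_def pf integral_complex_of_real ..
  then have Lf: "L f = 1" using f(2) by (simp add: integral_norm_eq_bergman1_norm)
  have dn: "dual_norm bergman1 bergman1_norm L = 1"
    unfolding dual_norm_def
  proof (rule cSup_eq_maximum)
    show "1 \<in> (\<lambda>f. cmod (L f)) ` {f \<in> bergman1. bergman1_norm f \<le> 1}"
      using f Lf by (intro image_eqI[of _ _ f]) auto
    show "x \<le> 1" if "x \<in> (\<lambda>f. cmod (L f)) ` {f \<in> bergman1. bergman1_norm f \<le> 1}" for x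
      using that Lb by force
  qed
  have "(\<lambda>k. bergman1_norm (\<lambda>z. x k z - f z)) \<longlonglongrightarrow> 0"
    if x: "\<And>k. x k \<in> bergman1 \<and> bergman1_norm (x k) \<le> 1" and Lx: "(\<lambda>k. L (x k)) \<longlonglongrightarrow> 1" for x :: "nat \<Rightarrow> complex \<Rightarrow> complex"
  proof (rule ccontr)
    assume "\<not> (\<lambda>k. bergman1_norm (\<lambda>z. x k z - f z)) \<longlonglongrightarrow> 0"
    then obtain e where e: "e > 0" "\<not> (\<forall>\<^sub>F k in sequentially. bergman1_norm (\<lambda>z. x k z - f z) < e)"
      unfolding tendsto_iff by (auto simp: dist_norm bergman1_norm_nonneg)
    from not_eventually_sequentiallyD[OF e(2)]
    obtain s :: "nat \<Rightarrow> nat" where s0: "strict_mono s \<and> (\<forall>n. \<not> bergman1_norm (\<lambda>z. x (s n) z - f z) < e)" ..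
    then have s: "strict_mono s" "\<And>n. bergman1_norm (\<lambda>z. x (s n) z - f z) \<ge> e"
      by (simp_all add: not_less)
    \<comment> \<open>Local boundedness of the unit ball of \<open>A^1\<close>, the hypothesis of
      Montel's theorem, which provides the limit \<open>g\<close> along a further
      subsequence.\<close>
    have bdd: "\<exists>B. \<forall>h\<in>{h\<in>bergman1. bergman1_norm h \<le> 1}. \<forall>z\<in>K. norm (h z) \<le> B"
      if K: "compact K" "K \<subseteq> ball 0 1" for K
    proof -
      obtain r where r: "r < 1" "\<And>z. z \<in> K \<Longrightarrow> norm z \<le> r"
      proof (cases "K = {}")
        case True
        then show ?thesis using that[of 0] by auto
      next
        case False
        then obtain z where "z \<in> K" "\<And>w. w \<in> K \<Longrightarrow> norm w \<le> norm z"
          using continuous_attains_sup[of K norm] K(1) by (auto intro: continuous_intros)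
        then show ?thesis using that[of "norm z"] K(2) by auto
      qed
      obtain M where "\<And>k z C. k \<in> bergman1 \<Longrightarrow> bergman1_norm k \<le> C \<Longrightarrow> norm (z::complex) \<le> r \<Longrightarrow> norm (k z) \<le> M * C"
        using dilated_pointwise_bound[OF r(1)] by metis
      then show ?thesis using r(2) by (intro exI[of _ "M * 1"]) blast
    qed
    have hol: "h holomorphic_on ball 0 1" if "h \<in> {h\<in>bergman1. bergman1_norm h \<le> 1}" for h
      using that by (auto simp: bergman1_iff)
    have rng: "range (\<lambda>n. x (s n)) \<subseteq> {h\<in>bergman1. bergman1_norm h \<le> 1}" using x by blast
    obtain g r where g: "g holomorphic_on ball 0 1" and r: "strict_mono (r :: nat \<Rightarrow> nat)"
      and lim: "\<And>z. z \<in> ball 0 1 \<Longrightarrow> (\<lambda>n. x (s (r n)) z) \<longlonglongrightarrow> g z"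
      by (rule Montel[OF open_ball hol bdd rng]) blast+
    define k where "k n = x (s (r n))" for n
    have k: "k n \<in> bergman1" "bergman1_norm (k n) \<le> 1" for n using x by (auto simp: k_def)
    have gb: "g \<in> bergman1" using lim by (intro bergman1_limit[of k 1 g] k g) (simp add: k_def)
    define d where "d n z = k n z - g z" for n z
    define t where "t = bergman1_norm g"
    \<comment> \<open>By the Brezis-Lieb lemma \<open>b\<close> tends to the norm \<open>t\<close>
      of the limit. As \<open>k n\<close> lies in the unit ball, the escaping part
      \<open>d n\<close> has norm at most 1 - b n.\<close>
    define b where "b n = bergman1_norm (k n) - bergman1_norm (d n)" for n
    have d: "d n \<in> bergman1" for n unfolding d_def using bergman1_diff[OF k(1) gb] .
    have d0: "(\<lambda>n. d n z) \<longlonglongrightarrow> 0" if "z \<in> ball 0 1" for z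
      using tendsto_diff[OF lim[OF that] tendsto_const[of "g z"]] by (simp add: d_def k_def)
    have db: "bergman1_norm (d n) \<le> 1 + t" for n
      using bergman1_norm_diff_le[OF k(1) gb, of n] k(2)[of n] by (simp add: d_def[abs_def] t_def)
    have "(\<lambda>n. (LINT z|disc. norm (k n z)) - (LINT z|disc. norm (k n z - g z))) \<longlonglongrightarrow> (LINT z|disc. norm (g z))"
      by (rule brezis_lieb) (use k gb lim in \<open>auto simp: bergman1_iff k_def\<close>)
    from tendsto_divide[OF this tendsto_const[of pi]] have bt: "b \<longlonglongrightarrow> t"
      by (simp add: b_def[abs_def] t_def bergman1_norm_eq diff_divide_distrib d_def)
    define \<epsilon> where "\<epsilon> n = norm (LINT z|disc. (\<phi> z - u z) * d n z) / pi" for n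
    have "(\<lambda>n. LINT z|disc. (\<phi> z - u z) * d n z) \<longlonglongrightarrow> 0"
      by (rule compact_symbolD[OF comp[folded \<phi>_def] d db d0])
    then have \<epsilon>: "\<epsilon> \<longlonglongrightarrow> 0"
      unfolding \<epsilon>_def[abs_def] by (auto intro!: tendsto_eq_intros)
    have Ld: "norm (L (d n)) \<le> \<epsilon> n + q * bergman1_norm (d n)" for n
    proof -
      have id: "integrable disc (d n)" using d by (simp add: bergman1_iff)
      have "(LINT z|disc. \<phi> z * d n z) = (LINT z|disc. (\<phi> z - u z) * d n z) + (LINT z|disc. u z * d n z)"
        using compact_symbol_integrable[OF comp[folded \<phi>_def] d] integral_norm_pairing_le(1)[OF u(1,2) id]
        by (subst Bochner_Integration.integral_add[symmetric]) (auto simp: algebra_simps)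
      then have "norm (LINT z|disc. \<phi> z * d n z) \<le> norm (LINT z|disc. (\<phi> z - u z) * d n z) + q * (LINT z|disc. norm (d n z))"
        using integral_norm_pairing_le(2)[OF u(1,2) id]
        by (metis (no_types, lifting) add_left_mono norm_triangle_ineq order_trans)
      from divide_right_mono[OF this, of pi] show ?thesis
        by (simp add: L_def norm_divide \<epsilon>_def add_divide_distrib integral_norm_eq_bergman1_norm)
    qed
    \<comment> \<open>In the limit this reads 1 \<le> t + q (1 - t), and q < 1 forces t \<ge> 1.
      Since 1 - b n is nonnegative, also t \<le> 1. Hence nothing escapes, and the limit is a
      norming element.\<close>
    have "Re (L (k n)) \<le> t + (\<epsilon> n + q * (1 - b n))" for n
    proof -
      have "L (k n) = L g + L (d n)" unfolding d_def using Ldiff[OF k(1) gb] by simp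
      then have "Re (L (k n)) \<le> norm (L g) + norm (L (d n))"
        using complex_Re_le_cmod[of "L g"] complex_Re_le_cmod[of "L (d n)"] by simp
      moreover have "norm (L g) \<le> t" unfolding t_def by (rule Lb[OF gb])
      moreover have "q * bergman1_norm (d n) \<le> q * (1 - b n)"
        using k(2)[of n] q0 by (intro mult_left_mono) (auto simp: b_def)
      ultimately show ?thesis using Ld[of n] by linarith
    qed
    moreover have Lk: "(\<lambda>n. L (k n)) \<longlonglongrightarrow> 1"
      using LIMSEQ_subseq_LIMSEQ[OF Lx strict_mono_o[OF s(1) r]] by (simp add: k_def o_def)
    moreover have "(\<lambda>n. t + (\<epsilon> n + q * (1 - b n))) \<longlonglongrightarrow> t + (0 + q * (1 - t))"
      by (intro tendsto_intros \<epsilon> bt)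
    ultimately have "Re 1 \<le> t + (0 + q * (1 - t))"
      by (intro LIMSEQ_le[OF tendsto_Re]) auto
    then have "(1 - q) * (t - 1) \<ge> 0" by (simp add: algebra_simps)
    then have t1: "t \<ge> 1" using u(3) by (simp add: zero_le_mult_iff)
    have bd: "bergman1_norm (d n) \<le> 1 - b n" for n using k(2)[of n] by (simp add: b_def)
    then have "0 \<le> 1 - b n" for n using bergman1_norm_nonneg order_trans by blast
    moreover have b1: "(\<lambda>n. 1 - b n) \<longlonglongrightarrow> 1 - t" by (intro tendsto_intros bt)
    ultimately have "0 \<le> 1 - t" by (intro LIMSEQ_le_const) auto
    with t1 have t: "t = 1" by simp
    have dn: "(\<lambda>n. bergman1_norm (d n)) \<longlonglongrightarrow> 0"
      by (rule tendsto_sandwich[OF _ _ tendsto_const b1[unfolded t, simplified]])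
        (use bd bergman1_norm_nonneg in auto)
    have "(\<lambda>n. L (d n)) \<longlonglongrightarrow> 0"
      by (rule Lim_null_comparison[OF _ dn]) (use Lb[OF d] in auto)
    from tendsto_diff[OF Lk this] have "(\<lambda>n. L g) \<longlonglongrightarrow> 1"
      using Ldiff[OF k(1) gb] by (simp add: d_def[abs_def])
    then have "L g = 1" by (simp add: LIMSEQ_const_iff)
    then have "(LINT z|disc. \<phi> z * g z) = of_real pi" by (simp add: L_def)
    then have "g z = f z" if "z \<in> ball 0 1" for z
      using bergman1_equality_case[OF f gb _ _ that] t by (simp add: t_def \<phi>_def)
    then have "bergman1_norm (d n) = bergman1_norm (\<lambda>z. k n z - f z)" for n
      by (intro bergman1_norm_cong) (auto simp: d_def)
    then have "bergman1_norm (d n) \<ge> e" for n using s(2) by (simp add: k_def)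
    then have "e \<le> 0" using LIMSEQ_le_const[OF dn] by blast
    then show False using e by simp
  qed
  then show ?thesis
    unfolding strongly_exposed_def using f dual Lf dn by blast
qed

section \<open>Products of powers\<close>

text \<open>A point of the closed disc with real part at least 1 can only be 1. So away from
  \<open>a\<close> the factor avoids the cut of the principal branch, and its phase is continuous up
  to the circle.\<close>

lemma Re_one_minus_mult_cnj_pos:
  assumes "norm a = 1" "norm z \<le> 1" "z \<noteq> a"
  shows "Re (1 - z * cnj a) > 0"
proof (rule ccontr)
  let ?\<zeta> = "z * cnj a"
  assume "\<not> Re (1 - ?\<zeta>) > 0"
  then have r: "Re ?\<zeta> \<ge> 1" by simp
  have n: "norm ?\<zeta> \<le> 1" using assms by (simp add: norm_mult)
  then have "Re ?\<zeta> = 1" using r complex_Re_le_cmod[of ?\<zeta>] by linarith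
  moreover have "(Re ?\<zeta>)\<^sup>2 + (Im ?\<zeta>)\<^sup>2 \<le> 1"
    using n power_le_one[of "norm ?\<zeta>" 2] by (simp only: cmod_power2 norm_ge_zero)
  ultimately have "?\<zeta> = 1" by (intro complex_eqI) (simp_all only: one_complex.simps, simp)
  moreover have "cnj a * a = 1"
    using complex_norm_square[of a] assms(1) by (simp add: mult.commute)
  ultimately have "z = a" by (metis mult.assoc mult.right_neutral mult_1)
  then show False using assms by simp
qed

lemma cnj_sgn_powr: "w \<noteq> 0 \<Longrightarrow> cnj (sgn (w powr of_real b)) = phase b w"
proof -
  assume w: "w \<noteq> 0"
  have "w powr of_real b = of_real (exp (b * ln (norm w))) * cis (b * Arg w)"
    using w by (simp add: powr_def Arg_eq_Im_Ln exp_eq_polar)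
  moreover have "sgn (cis t) = cis t" for t by (simp add: sgn_div_norm)
  ultimately have "sgn (w powr of_real b) = cis (b * Arg w)"
    by (simp add: sgn_mult sgn_of_real)
  then show ?thesis by (simp add: phase_def cis_cnj)
qed

lemma phase_continuous_at:
  assumes "Re w > 0"
  shows "isCont (phase b) w"
proof -
  have "open {w. Re w > 0}" by (intro open_Collect_less continuous_intros)
  then show ?thesis using continuous_on_phase assms by (simp add: continuous_on_eq_continuous_at)
qed

lemma phase_compose_continuous:
  assumes "norm a = 1" "norm z \<le> 1" "z \<noteq> a"
  shows "continuous (at z within S) (\<lambda>z. phase b (1 - z * cnj a))"
proof (rule continuous_at_imp_continuous_at_within)
  have "isCont (\<lambda>z. 1 - z * cnj a) z" by (intro continuous_intros)
  then show "isCont (\<lambda>z. phase b (1 - z * cnj a)) z"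
    by (rule isCont_o2[where g = "phase b" and f = "\<lambda>z. 1 - z * cnj a", OF _ phase_continuous_at[OF Re_one_minus_mult_cnj_pos[OF assms]]])
qed

text \<open>\<open>P\<close> may be discontinuous at x; a factor vanishing there absorbs its jump.
  Used for phases at their own singular point.\<close>

lemma continuous_null_times_bounded:
  fixes A P :: "'a::t2_space \<Rightarrow> 'b::real_normed_algebra"
  assumes "continuous (at x within S) A" "A x = 0" "\<And>y. norm (P y) \<le> B"
  shows "continuous (at x within S) (\<lambda>y. A y * P y)"
proof -
  have "((\<lambda>y. A y * P y) \<longlongrightarrow> 0) (at x within S)"
  proof (rule Lim_null_comparison)
    show "\<forall>\<^sub>F y in at x within S. norm (A y * P y) \<le> norm (A y) * B"
      by (intro always_eventually allI order_trans[OF norm_mult_ineq] mult_left_mono assms) auto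
    have "((\<lambda>y. norm (A y) * B) \<longlongrightarrow> norm (0::'b) * B) (at x within S)"
      using assms(1,2) by (intro tendsto_intros) (simp add: continuous_within)
    then show "((\<lambda>y. norm (A y) * B) \<longlongrightarrow> 0) (at x within S)" by simp
  qed
  then show ?thesis using assms(2) by (simp add: continuous_within)
qed

text \<open>The zeros of g form a compact set that misses the circle, so their moduli have a maximum
  below 1.\<close>

lemma nonzero_near_circle:
  assumes g: "continuous_on (cball 0 1) g" and nz: "\<And>z. z \<in> sphere 0 1 \<Longrightarrow> g z \<noteq> (0::complex)"
  obtains r where "0 \<le> r" "r < 1" "\<And>z::complex. r \<le> norm z \<Longrightarrow> norm z \<le> 1 \<Longrightarrow> g z \<noteq> 0"
proof -
  define K where "K = cball 0 1 \<inter> g -` {0}"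
  have "compact K"
    unfolding compact_eq_bounded_closed K_def
    by (intro conjI bounded_subset[OF bounded_cball[of 0 1]] continuous_closed_preimage[OF g]) auto
  show ?thesis
  proof (cases "K = {}")
    case True
    then have "g z \<noteq> 0" if "norm z \<le> 1" for z
      using that by (force simp: K_def)
    then show ?thesis using that[of 0] by simp
  next
    case False
    obtain z where z: "z \<in> K" "\<And>w. w \<in> K \<Longrightarrow> norm w \<le> norm z"
      using continuous_attains_sup[OF \<open>compact K\<close> False, of norm] by (auto intro: continuous_intros)
    have "norm z < 1" using z(1) nz[of z] by (force simp: K_def)
    show ?thesis
    proof (rule that[of "(norm z + 1) / 2"])
      show "g w \<noteq> 0" if "(norm z + 1) / 2 \<le> norm w" "norm w \<le> 1" for w
      proof
        assume "g w = 0"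
        then have "w \<in> K" using that by (simp add: K_def)
        from z(2)[OF this] show False using that \<open>norm z < 1\<close> by simp
      qed
    qed (use \<open>norm z < 1\<close> in \<open>auto simp: add_nonneg_nonneg\<close>)
  qed
qed

lemma finite_separated:
  assumes "finite (Z :: 'a::metric_space set)"
  obtains d where "d > 0" "\<And>a b. a \<in> Z \<Longrightarrow> b \<in> Z \<Longrightarrow> a \<noteq> b \<Longrightarrow> 2 * d \<le> dist a b"
proof -
  \<comment> \<open>The element 1 keeps the set nonempty when there are fewer than two
    points.\<close>
  define D where "D = insert 1 ((\<lambda>(a, b). dist a b) ` {(a, b) \<in> Z \<times> Z. a \<noteq> b})"
  have f: "finite D" using assms by (auto simp: D_def intro: finite_subset[of _ "Z \<times> Z"])
  have "Min D \<in> D" using f by (intro Min_in) (auto simp: D_def)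
  then have "Min D > 0" by (auto simp: D_def)
  moreover have "Min D \<le> dist a b" if "a \<in> Z" "b \<in> Z" "a \<noteq> b" for a b
    using f that by (intro Min_le) (auto simp: D_def)
  ultimately show ?thesis by (intro that[of "Min D / 2"]) auto
qed

lemma compact_symbol_phase_rotated:
  assumes "norm a = 1"
  shows "compact_symbol (\<lambda>z. phase_symbol b (z * cnj a))"
  using compact_symbol_rotate[OF phase_symbol_measurable norm_phase_symbol summable_phase_symbol_moments, of "cnj a"] assms
  by (simp add: mult.commute)

definition bump :: "real \<Rightarrow> complex \<Rightarrow> complex \<Rightarrow> complex" where
  "bump d a z = of_real (max 0 (1 - dist z a / d))"

lemma bump_props:
  assumes "d > 0"
  shows "continuous_on S (bump d a)" "bump d a a = 1" "norm (bump d a z) \<le> 1"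
    "dist z a \<ge> d \<Longrightarrow> bump d a z = 0"
proof -
  show "continuous_on S (bump d a)"
    unfolding bump_def[abs_def] using assms by (intro continuous_intros) auto
  show "bump d a a = 1" by (simp add: bump_def)
  show "norm (bump d a z) \<le> 1" using assms by (auto simp: bump_def)
  show "dist z a \<ge> d \<Longrightarrow> bump d a z = 0" using assms by (simp add: bump_def max_def field_simps)
qed

text \<open>The bumps have disjoint supports because of the factor 2, so at most one term is nonzero
  at \<open>z\<close> and the bound is the common bound \<open>q\<close> of the terms, not its
  multiple by the number of points. Otherwise several defects below 1 could add up to more than
  1.\<close>

lemma norm_sum_bumps_le:
  assumes d: "d > 0" "\<And>a b. a \<in> Z \<Longrightarrow> b \<in> Z \<Longrightarrow> a \<noteq> b \<Longrightarrow> 2 * d \<le> dist a b"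
    and Z: "finite Z" and q: "q \<ge> 0" "\<And>a. a \<in> Z \<Longrightarrow> norm (c a) \<le> q"
  shows "norm (\<Sum>a\<in>Z. bump d a z * c a) \<le> q"
proof (cases "\<exists>a\<in>Z. dist z a < d")
  case True
  then obtain a where a: "a \<in> Z" "dist z a < d" by blast
  have "bump d b z = 0" if "b \<in> Z - {a}" for b
  proof (rule bump_props(4)[OF d(1)])
    have "2 * d \<le> dist a b" using a that by (intro d) auto
    then show "d \<le> dist z b" using a(2) dist_triangle[of a b z] by (simp add: dist_commute)
  qed
  then have "(\<Sum>b\<in>Z. bump d b z * c b) = (\<Sum>b\<in>{a}. bump d b z * c b)"
    using Z a(1) by (intro sum.mono_neutral_right) auto
  moreover have "norm (bump d a z * c a) \<le> 1 * q"
    unfolding norm_mult using bump_props(3)[OF d(1)] q a(1) by (intro mult_mono) auto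
  ultimately show ?thesis by simp
next
  case False
  then have "(\<Sum>b\<in>Z. bump d b z * c b) = 0"
    using bump_props(4)[OF d(1)] by (intro sum.neutral) (auto simp: not_less)
  then show ?thesis using q by simp
qed

text \<open>Near the circle \<open>cnj (sgn f)\<close> is split into \<open>u + v + E\<close>:
  \<open>v\<close> collects the corrected phases and is compact, \<open>u\<close> collects the
  localised remainders and has norm at most \<open>q\<close>, and \<open>E\<close> is continuous up
  to the circle.\<close>

theorem strongly_exposed_power_product:
  assumes f: "f \<in> bergman1" "bergman1_norm f = 1"
    and g: "continuous_on (cball 0 1) g" "\<And>z. z \<in> sphere 0 1 \<Longrightarrow> g z \<noteq> 0"
    and Z: "finite Z" "Z \<subseteq> sphere 0 1" and \<beta>: "\<And>a. a \<in> Z \<Longrightarrow> \<beta> a > -2"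
    and eq: "\<And>z. z \<in> ball 0 1 \<Longrightarrow> f z = g z * (\<Prod>a\<in>Z. (1 - z * cnj a) powr of_real (\<beta> a))"
  shows "strongly_exposed_bergman1 f"
proof -
  have na: "norm a = 1" if "a \<in> Z" for a using that Z(2) by auto
  obtain r where r: "0 \<le> r" "r < 1" and gnz: "\<And>z. r \<le> norm z \<Longrightarrow> norm z \<le> 1 \<Longrightarrow> g z \<noteq> 0"
    using nonzero_near_circle[OF g] by blast
  obtain d where d: "d > 0" "\<And>a b. a \<in> Z \<Longrightarrow> b \<in> Z \<Longrightarrow> a \<noteq> b \<Longrightarrow> 2 * d \<le> dist a b"
    using finite_separated[OF Z(1)] by metis
  define S where "S = {z::complex. r \<le> norm z \<and> norm z \<le> 1}"
  define P where "P a z = phase (\<beta> a) (1 - z * cnj a)" for a z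
  define Q where "Q a z = phase (-2) (1 - z * cnj a)" for a z
  \<comment> \<open>All factors of \<open>cnj (sgn f)\<close> except the singular one at
    \<open>a\<close>. This product is continuous at \<open>a\<close>; \<open>u\<close>,
    \<open>v\<close> and \<open>E\<close> use its frozen value \<open>A a a\<close>.\<close>
  define A where "A a z = cnj (sgn (g z)) * (\<Prod>b\<in>Z - {a}. P b z)" for a z
  define l where "l a = complex_of_real (phase_defect (\<beta> a))" for a
  \<comment> \<open>Inserting 0 makes the maximum meaningful for empty \<open>Z\<close> and keeps it
    nonnegative.\<close>
  define q where "q = Max (insert 0 ((\<lambda>a. \<bar>phase_defect (\<beta> a)\<bar>) ` Z))"
  define u where "u z = (\<Sum>a\<in>Z. bump d a z * (A a a * l a * Q a z))" for z
  \<comment> \<open>The first part is the error of freezing the regular factors, the second what the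
    bumps cut away from the remainders.\<close>
  define E where "E z = (cnj (sgn (g z)) * (\<Prod>a\<in>Z. P a z) - (\<Sum>a\<in>Z. A a a * P a z))
      + (\<Sum>a\<in>Z. A a a * l a * ((1 - bump d a z) * Q a z))" for z
  have nP: "norm (P a z) \<le> 1" and nQ: "norm (Q a z) \<le> 1" for a z by (simp_all add: P_def Q_def)
  have nA: "norm (A a z) \<le> 1" for a z
    by (auto simp: A_def norm_mult norm_sgn prod_norm[symmetric] P_def)
  have q: "q \<ge> 0" "q < 1" "\<And>a. a \<in> Z \<Longrightarrow> \<bar>phase_defect (\<beta> a)\<bar> \<le> q"
    using Z(1) phase_defect_less \<beta> by (auto simp: q_def intro: Max_ge)
  have un: "norm (u z) \<le> q" for z
    unfolding u_def
  proof (rule norm_sum_bumps_le[OF d Z(1) q(1)])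
    fix a assume "a \<in> Z"
    have "norm (A a a * l a * Q a z) \<le> 1 * q * 1"
      unfolding norm_mult using q(1) q(3)[OF \<open>a \<in> Z\<close>] nA nQ by (intro mult_mono) (auto simp: l_def)
    then show "norm (A a a * l a * Q a z) \<le> q" by simp
  qed
  have contQ: "continuous_on (ball 0 1) (Q a)" and contP: "continuous_on (ball 0 1) (P a)" if "a \<in> Z" for a
    unfolding Q_def[abs_def] P_def[abs_def] continuous_on_eq_continuous_within
    using na[OF that] by (auto intro!: phase_compose_continuous)
  have um: "u \<in> borel_measurable disc"
    unfolding u_def[abs_def]
    by (intro continuous_on_imp_measurable_disc continuous_intros contQ bump_props(1)[OF d(1)])
  have \<Phi>: "cnj (sgn (f z)) = cnj (sgn (g z)) * (\<Prod>a\<in>Z. P a z)" if z: "z \<in> ball 0 1" for z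
  proof -
    have "cnj (sgn (\<Prod>a\<in>X. (1 - z * cnj a) powr of_real (\<beta> a))) = (\<Prod>a\<in>X. P a z)" if "finite X" "X \<subseteq> Z" for X
      using that
    proof (induction X)
      case (insert a X)
      have "Re (1 - z * cnj a) > 0"
        using z insert.prems na by (intro Re_one_minus_mult_cnj_pos) auto
      then have "1 - z * cnj a \<noteq> 0" by (metis less_irrefl zero_complex.simps(1))
      then show ?case using insert by (simp add: sgn_mult cnj_sgn_powr P_def)
    qed simp
    from this[OF Z(1) order_refl] show ?thesis by (simp add: eq[OF z] sgn_mult)
  qed
  have fm: "(\<lambda>z. cnj (sgn (f z))) \<in> borel_measurable disc"
    using f by (intro borel_measurable_cnj_sgn) (auto simp: bergman1_iff)
  define v where "v z = (\<Sum>a\<in>Z. A a a * phase_symbol (\<beta> a) (z * cnj a))" for z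
  have vc: "compact_symbol v"
    unfolding v_def[abs_def] by (intro compact_symbol_sum compact_symbol_cmult compact_symbol_phase_rotated na)
  obtain B where B: "\<And>z. z \<in> ball 0 1 \<Longrightarrow> norm (v z) \<le> B"
    using compact_symbol_bounded[OF vc] by blast
  have "compact_symbol (\<lambda>z. cnj (sgn (f z)) - u z - v z)"
  proof (rule compact_symbol_extends_continuously[where r = r and v = E and B = "1 + q + B"])
    show "(\<lambda>z. cnj (sgn (f z)) - u z - v z) \<in> borel_measurable disc"
      using fm um compact_symbol_measurable[OF vc] by auto
    show "norm (cnj (sgn (f z)) - u z - v z) \<le> 1 + q + B" if "z \<in> ball 0 1" for z
    proof -
      have "norm (cnj (sgn (f z))) \<le> 1" by (simp add: norm_sgn)
      then show ?thesis using un[of z] B[OF that]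
        norm_triangle_ineq4[of "cnj (sgn (f z)) - u z" "v z"] norm_triangle_ineq4[of "cnj (sgn (f z))" "u z"] by linarith
    qed
    show "cnj (sgn (f z)) - u z - v z = E z" if "r \<le> norm z" "norm z < 1" for z
    proof -
      have "A a a * phase_symbol (\<beta> a) (z * cnj a) = A a a * P a z - A a a * l a * Q a z" for a
        by (simp add: phase_symbol_def P_def Q_def l_def algebra_simps)
      then have "v z = (\<Sum>a\<in>Z. A a a * P a z) - (\<Sum>a\<in>Z. A a a * l a * Q a z)"
        by (simp add: v_def sum_subtractf)
      moreover have "(\<Sum>a\<in>Z. A a a * l a * ((1 - bump d a z) * Q a z)) = (\<Sum>a\<in>Z. A a a * l a * Q a z) - u z"
        unfolding u_def sum_subtractf[symmetric] by (intro sum.cong refl) (simp add: algebra_simps)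
      ultimately show ?thesis using \<Phi>[of z] that by (simp add: E_def)
    qed
    have "continuous (at z within S) E" if z: "z \<in> S" for z
    proof -
      have z1: "norm z \<le> 1" and gz: "g z \<noteq> 0" using z gnz by (auto simp: S_def)
      have "continuous_on S g" by (rule continuous_on_subset[OF g(1)]) (auto simp: S_def)
      then have cg: "continuous (at z within S) (\<lambda>z. cnj (sgn (g z)))"
        using gz z by (intro continuous_intros) (auto simp: continuous_on_eq_continuous_within)
      have cP: "continuous (at z within S) (P a)" and cQ: "continuous (at z within S) (Q a)" if "a \<in> Z" "a \<noteq> z" for a
        unfolding P_def[abs_def] Q_def[abs_def] using that z1 na by (auto intro!: phase_compose_continuous)
      have cA: "continuous (at z within S) (A a)" if "z \<notin> Z - {a}" for a
        unfolding A_def[abs_def] using that by (intro continuous_intros cg cP) auto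
      have cb: "continuous (at z within S) (bump d a)" for a
        using bump_props(1)[OF d(1), of S a] z by (simp add: continuous_on_eq_continuous_within)
      \<comment> \<open>At its own point \<open>Q a\<close> has no limit, but 1 -
        \<open>bump d a\<close> vanishes there.\<close>
      have c2: "continuous (at z within S) (\<lambda>z. (1 - bump d a z) * Q a z)" if a: "a \<in> Z" for a
      proof (cases "a = z")
        case True
        then show ?thesis using nQ bump_props(2)[OF d(1)]
          by (intro continuous_null_times_bounded[where B = 1] continuous_intros cb) auto
      next
        case False
        then show ?thesis using a by (intro continuous_intros cb cQ)
      qed
      have c1: "continuous (at z within S) (\<lambda>z. cnj (sgn (g z)) * (\<Prod>a\<in>Z. P a z) - (\<Sum>a\<in>Z. A a a * P a z))"
      proof (cases "z \<in> Z")
        case False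
        then show ?thesis by (intro continuous_intros cg cP) auto
      next
        case True
        \<comment> \<open>Isolates the one phase that is discontinuous at \<open>z\<close>; its
          coefficient \<open>A z w - A z z\<close> tends to 0 as w approaches \<open>z\<close>, and
          all other terms are continuous there.\<close>
        have e: "cnj (sgn (g w)) * (\<Prod>a\<in>Z. P a w) - (\<Sum>a\<in>Z. A a a * P a w)
            = (A z w - A z z) * P z w - (\<Sum>a\<in>Z - {z}. A a a * P a w)" for w
          unfolding prod.remove[OF Z(1) True] sum.remove[OF Z(1) True]
          by (simp add: A_def[of z w] algebra_simps)
        show ?thesis
          unfolding e using nP
          by (intro continuous_diff[OF continuous_null_times_bounded[where B = 1]] continuous_intros cA cP) auto
      qed
      show ?thesis unfolding E_def[abs_def] by (intro continuous_intros c1 c2)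
    qed
    then show "continuous_on {z. r \<le> norm z \<and> norm z \<le> 1} E"
      by (simp add: S_def continuous_on_eq_continuous_within)
  qed (rule r)
  from compact_symbol_add[OF this vc] have "compact_symbol (\<lambda>z. cnj (sgn (f z)) - u z)" by simp
  then show ?thesis by (rule strongly_exposed_bergman1I[OF f um un q(2)])
qed

section \<open>Powers and polynomials\<close>

lemma nn_integral_powr_finite:
  assumes "a > -1" "c \<ge> 0"
  shows "(\<integral>\<^sup>+x. ennreal (x powr a) * indicator {0..c} x \<partial>lborel) < \<infinity>"
  using has_integral_powr_from_0[OF assms] by (subst nn_integral_has_integral_lebesgue') auto

lemma nn_integral_abs_powr_finite:
  assumes "a > -1"
  shows "(\<integral>\<^sup>+y. ennreal (\<bar>y\<bar> powr a) * indicator {-1..1} y \<partial>lborel) < \<infinity>"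
proof -
  let ?g = "\<lambda>y::real. ennreal (y powr a) * indicator {0..1} y"
  have "(\<integral>\<^sup>+y. ennreal (\<bar>y\<bar> powr a) * indicator {-1..1} y \<partial>lborel) \<le> (\<integral>\<^sup>+y. ?g y + ?g (- y) \<partial>lborel)"
    by (intro nn_integral_mono) (auto simp: indicator_def)
  also have "\<dots> = (\<integral>\<^sup>+y. ?g y \<partial>lborel) + (\<integral>\<^sup>+y. ?g (- y) \<partial>lborel)"
    by (rule nn_integral_add) auto
  also have "(\<integral>\<^sup>+y. ?g (- y) \<partial>lborel) = (\<integral>\<^sup>+y. ?g y \<partial>lborel)"
    using nn_integral_real_affine[of ?g "-1" 0] by simp
  also have "(\<integral>\<^sup>+y. ?g y \<partial>lborel) + (\<integral>\<^sup>+y. ?g y \<partial>lborel) < \<infinity>"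
    using nn_integral_powr_finite[OF assms, of 1] by simp
  finally show ?thesis .
qed

lemma powr_holomorphic_disc:
  assumes "norm a = 1"
  shows "(\<lambda>z. (1 - z * cnj a) powr of_real b) holomorphic_on ball 0 1"
proof -
  have "1 - z * cnj a \<notin> \<real>\<^sub>\<le>\<^sub>0" if "z \<in> ball 0 1" for z
  proof -
    have "Re (1 - z * cnj a) > 0"
      using that assms by (intro Re_one_minus_mult_cnj_pos) auto
    then show ?thesis by (simp add: complex_nonpos_Reals_iff)
  qed
  then show ?thesis by (auto intro!: holomorphic_intros)
qed

text \<open>For negative b the estimate |1 - z|^2 \<ge> (1 - x) |y| bounds the power by a product of
  one-variable powers with exponent b / 2 > -1, each integrable.\<close>

lemma one_minus_powr_bergman1:
  assumes b: "b > -2"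
  shows "(\<lambda>z. (1 - z) powr of_real b) \<in> bergman1"
proof -
  let ?h = "\<lambda>z::complex. (1 - z) powr of_real b"
  have hol: "?h holomorphic_on ball 0 1" using powr_holomorphic_disc[of 1 b] by simp
  then have m: "?h \<in> borel_measurable disc"
    by (intro continuous_on_imp_measurable_disc holomorphic_on_imp_continuous_on)
  have n: "norm (?h z) = norm (1 - z) powr b" for z
    by (simp add: norm_powr_real_powr')
  have "integrable disc ?h"
  proof (cases "b \<ge> 0")
    case True
    show ?thesis
    proof (rule integrable_disc_bounded[OF m])
      show "norm (?h z) \<le> 2 powr b" if "z \<in> ball 0 1" for z
        unfolding n using that True norm_triangle_ineq4[of 1 z] by (intro powr_mono2) auto
    qed
  next
    case False
    define a where "a = b / 2"
    have a: "a > -1" "a < 0" using b False by (auto simp: a_def)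
    let ?G = "\<lambda>x::real. ennreal ((1 - x) powr a) * indicator {-1..1} x"
    let ?H = "\<lambda>y::real. ennreal (\<bar>y\<bar> powr a) * indicator {-1..1} y"
    \<comment> \<open>The real axis is excluded because \<open>0 powr a = 0\<close> would make the
      right-hand side vanish; it is a null set for every x.\<close>
    have le: "ennreal (norm (?h (Complex x y))) * indicator (ball 0 1) (Complex x y) \<le> ?G x * ?H y"
      if "y \<noteq> 0" for x y
    proof (cases "Complex x y \<in> ball 0 1")
      case True
      then have xy: "\<bar>x\<bar> < 1" "\<bar>y\<bar> < 1"
        using abs_Re_le_cmod[of "Complex x y"] abs_Im_le_cmod[of "Complex x y"] by auto
      have "(1 - x) * \<bar>y\<bar> \<le> (norm (1 - Complex x y))\<^sup>2"
      proof -
        have "(norm (1 - Complex x y))\<^sup>2 = (1 - x)\<^sup>2 + \<bar>y\<bar>\<^sup>2" by (simp add: cmod_power2)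
        moreover have "(1 - x)\<^sup>2 + \<bar>y\<bar>\<^sup>2 - (1 - x) * \<bar>y\<bar> = ((1 - x) - \<bar>y\<bar>)\<^sup>2 + (1 - x) * \<bar>y\<bar>"
          by (simp add: power2_eq_square algebra_simps)
        moreover have "(1 - x) * \<bar>y\<bar> \<ge> 0" using xy by simp
        ultimately show ?thesis using zero_le_power2[of "(1 - x) - \<bar>y\<bar>"] by linarith
      qed
      then have "((norm (1 - Complex x y))\<^sup>2) powr a \<le> ((1 - x) * \<bar>y\<bar>) powr a"
        using a xy that by (intro powr_mono2') auto
      also have "((norm (1 - Complex x y))\<^sup>2) powr a = norm (?h (Complex x y))"
        unfolding n by (simp add: powr_powr a_def flip: powr_numeral)
      also have "((1 - x) * \<bar>y\<bar>) powr a = (1 - x) powr a * \<bar>y\<bar> powr a"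
        using xy by (simp add: powr_mult)
      finally have "ennreal (norm (?h (Complex x y))) \<le> ennreal ((1 - x) powr a) * ennreal (\<bar>y\<bar> powr a)"
        by (simp add: ennreal_mult[symmetric] ennreal_leI)
      moreover have "indicator {-1..1} x = (1::ennreal)" "indicator {-1..1} y = (1::ennreal)"
        using xy by (auto simp: indicator_def)
      ultimately show ?thesis using True by simp
    qed simp
    have mh: "(\<lambda>z. ennreal (norm (?h z)) * indicator (ball 0 1) z) \<in> borel_measurable borel"
    proof -
      have "(\<lambda>z. norm (indicator (ball 0 1) z *\<^sub>R ?h z)) \<in> borel_measurable borel"
        using m[unfolded borel_measurable_disc_iff] by measurable
      then have "(\<lambda>z. ennreal (norm (indicator (ball 0 1) z *\<^sub>R ?h z))) \<in> borel_measurable borel"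
        by simp
      moreover have "ennreal (norm (indicator (ball 0 1) z *\<^sub>R ?h z)) = ennreal (norm (?h z)) * indicator (ball 0 1) z" for z
        by (auto simp: indicator_def)
      ultimately show ?thesis by (simp only:)
    qed
    have "(\<integral>\<^sup>+z. norm (?h z) \<partial>disc) = (\<integral>\<^sup>+z. ennreal (norm (?h z)) * indicator (ball 0 1) z \<partial>lborel)"
      unfolding disc_def by (subst nn_integral_restrict_space) auto
    also have "\<dots> = (\<integral>\<^sup>+x. \<integral>\<^sup>+y. ennreal (norm (?h (Complex x y))) * indicator (ball 0 1) (Complex x y) \<partial>lborel \<partial>lborel)"
      by (rule nn_integral_complex_iterated[OF mh])
    also have "\<dots> \<le> (\<integral>\<^sup>+x. \<integral>\<^sup>+y. ?G x * ?H y \<partial>lborel \<partial>lborel)"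
    proof (rule nn_integral_mono, rule nn_integral_mono_AE)
      fix x :: real
      have "AE y in lborel. y \<noteq> (0::real)" by (rule AE_lborel_singleton)
      then show "AE y in lborel. ennreal (norm (?h (Complex x y))) * indicator (ball 0 1) (Complex x y) \<le> ?G x * ?H y"
        by eventually_elim (rule le)
    qed
    also have "\<dots> = (\<integral>\<^sup>+x. ?G x \<partial>lborel) * (\<integral>\<^sup>+y. ?H y \<partial>lborel)"
      by (simp add: nn_integral_cmult nn_integral_multc)
    also have "\<dots> < \<infinity>"
    proof -
      have "(\<integral>\<^sup>+x. ?G x \<partial>lborel) = (\<integral>\<^sup>+x. ?G (1 + (-1) * x) \<partial>lborel)"
        using nn_integral_real_affine[of ?G "-1" 1] by simp
      also have "(\<lambda>x. ?G (1 + (-1) * x)) = (\<lambda>x. ennreal (x powr a) * indicator {0..2} x)"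
        by (auto simp: fun_eq_iff indicator_def)
      also have "(\<integral>\<^sup>+x. ennreal (x powr a) * indicator {0..2} x \<partial>lborel) < \<infinity>"
        by (rule nn_integral_powr_finite[OF a(1)]) simp
      finally show ?thesis
        using nn_integral_abs_powr_finite[OF a(1)] by (simp add: ennreal_mult_less_top)
    qed
    finally show ?thesis using m by (simp add: integrable_iff_bounded)
  qed
  then show ?thesis using hol by (simp add: bergman1_iff)
qed

section \<open>Normalised powers and polynomials as instances\<close>

lemma bergman1_norm_cmult: "bergman1_norm (\<lambda>z. c * f z) = norm c * bergman1_norm f"
  by (simp add: bergman1_norm_eq norm_mult)

lemma f_power_bergman1:
  assumes b: "b > -2"
  shows "f_power b \<in> bergman1" "bergman1_norm (f_power b) = 1"
proof -
  let ?h = "\<lambda>z::complex. (1 - z) powr of_real b"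
  have h: "?h \<in> bergman1" by (rule one_minus_powr_bergman1[OF b])
  then have i: "integrable disc (\<lambda>z. norm (?h z))" by (simp add: bergman1_iff)
  have "bergman1_norm ?h \<noteq> 0"
  proof
    assume "bergman1_norm ?h = 0"
    then have "(LINT z|disc. norm (?h z)) = 0" by (simp add: bergman1_norm_eq)
    then have "AE z in disc. norm (?h z) = 0"
      using integral_nonneg_eq_0_iff_AE[OF i] by simp
    moreover have "AE z in disc. z \<in> ball 0 1" by (rule AE_I2) simp
    ultimately have "AE z in disc. z \<notin> ball 0 1"
      by eventually_elim auto
    then have "ball (0::complex) 1 = {}" by (intro AE_disc_open_empty) auto
    then show False by simp
  qed
  then have pos: "bergman1_norm ?h > 0" using bergman1_norm_nonneg[of ?h] by simp
  \<comment> \<open>The norm is positive because the power has no zero in the disc, so exactly one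
    positive constant normalises it and the definite description is justified.\<close>
  have c: "c_const b = 1 / bergman1_norm ?h"
    unfolding c_const_def bergman1_norm_cmult norm_of_real using pos by (intro the_equality) (auto simp: field_simps)
  then show "bergman1_norm (f_power b) = 1"
    unfolding f_power_def bergman1_norm_cmult c norm_of_real using pos by simp
  show "f_power b \<in> bergman1"
    using h unfolding f_power_def bergman1_iff by (auto intro!: holomorphic_intros)
qed

lemma strongly_exposed_f_power:
  assumes "b > -2"
  shows "strongly_exposed_bergman1 (f_power b)"
proof (rule strongly_exposed_power_product[where g = "\<lambda>_. of_real (c_const b)" and Z = "{1}" and \<beta> = "\<lambda>_. b"])
  have "c_const b \<noteq> 0"
    using f_power_bergman1(2)[OF assms] by (auto simp: f_power_def bergman1_norm_eq)
  then show "complex_of_real (c_const b) \<noteq> 0" for z :: complex by simp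
qed (use f_power_bergman1[OF assms] assms in \<open>auto simp: f_power_def\<close>)

text \<open>The integral of a non-integrable function is 0 by convention, so a nonzero value of the
  norm certifies integrability.\<close>

lemma bergman1I_norm:
  assumes "f holomorphic_on ball 0 1" "bergman1_norm f \<noteq> 0"
  shows "f \<in> bergman1"
proof -
  have "f \<in> borel_measurable disc"
    by (intro continuous_on_imp_measurable_disc holomorphic_on_imp_continuous_on assms)
  moreover have "integrable disc (\<lambda>z. norm (f z))"
    using assms(2) not_integrable_integral_eq by (force simp: bergman1_norm_eq)
  ultimately show ?thesis using assms(1) by (simp add: bergman1_iff integrable_norm_iff)
qed

lemma strongly_exposed_normalized_power_product:
  assumes f: "bergman1_norm f = 1"
    and g: "g holomorphic_on ball 0 1" "continuous_on (cball 0 1) g" "\<And>z. z \<in> sphere 0 1 \<Longrightarrow> g z \<noteq> 0"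
    and Z: "finite Z" "Z \<subseteq> sphere 0 1" and \<beta>: "\<And>a. a \<in> Z \<Longrightarrow> \<beta> a > -2"
    and eq: "\<And>z. z \<in> ball 0 1 \<Longrightarrow> f z = g z * (\<Prod>a\<in>Z. (1 - z * cnj a) powr of_real (\<beta> a))"
  shows "strongly_exposed_bergman1 f"
proof (rule strongly_exposed_power_product[OF _ f g(2,3) Z \<beta> eq])
  have "(\<lambda>z. g z * (\<Prod>a\<in>Z. (1 - z * cnj a) powr of_real (\<beta> a))) holomorphic_on ball 0 1"
    using Z(2) by (intro holomorphic_intros g powr_holomorphic_disc) auto
  then have "f holomorphic_on ball 0 1" using holomorphic_cong eq by (metis (no_types, lifting))
  then show "f \<in> bergman1" by (rule bergman1I_norm) (simp add: f)
qed

text \<open>For |a| = 1 one has z - a = -a (1 - z cnj a). Roots on the circle thus become power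
  factors with their multiplicity as exponent, and all other roots go into \<open>g\<close>, which
  has no zero on the circle.\<close>

lemma strongly_exposed_poly:
  assumes "bergman1_norm (poly p) = 1"
  shows "strongly_exposed_bergman1 (poly p)"
proof -
  have p: "p \<noteq> 0"
  proof
    assume "p = 0"
    then have "bergman1_norm (poly p) = 0" by (simp add: bergman1_norm_eq)
    then show False using assms by simp
  qed
  define R where "R = {a. poly p a = 0}"
  define Z where "Z = R \<inter> sphere 0 1"
  define g where "g z = lead_coeff p * (\<Prod>a\<in>R - Z. (z - a) ^ order a p) * (\<Prod>a\<in>Z. (- a) ^ order a p)" for z
  have R: "finite R" using p by (simp add: R_def poly_roots_finite)
  then have Z: "finite Z" "Z \<subseteq> R" by (auto simp: Z_def)
  have fac: "(z - a) ^ k = (- a) ^ k * (1 - z * cnj a) ^ k" if "a \<in> Z" for z a k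
  proof -
    have "a * cnj a = 1" using that complex_norm_square[of a] by (simp add: Z_def)
    then have "z - a = - a * (1 - z * cnj a)" by (simp add: algebra_simps)
    then show ?thesis by (simp only: power_mult_distrib)
  qed
  show ?thesis
  proof (rule strongly_exposed_normalized_power_product[where g = g and Z = Z and \<beta> = "\<lambda>a. real (order a p)", OF assms])
    show "g holomorphic_on ball 0 1" unfolding g_def by (intro holomorphic_intros)
    show "continuous_on (cball 0 1) g" unfolding g_def by (intro continuous_intros)
    show "g z \<noteq> 0" if "z \<in> sphere 0 1" for z
      using p R Z that by (auto simp: g_def Z_def)
    fix z :: complex assume z: "z \<in> ball 0 1"
    have "poly p z = lead_coeff p * (\<Prod>a\<in>R. (z - a) ^ order a p)"
      by (subst complex_poly_decompose[of p, symmetric]) (simp add: poly_prod R_def)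
    also have "(\<Prod>a\<in>R. (z - a) ^ order a p) = (\<Prod>a\<in>R - Z. (z - a) ^ order a p) * (\<Prod>a\<in>Z. (z - a) ^ order a p)"
      by (rule prod.subset_diff[OF Z(2) R])
    also have "(\<Prod>a\<in>Z. (z - a) ^ order a p) = (\<Prod>a\<in>Z. (- a) ^ order a p) * (\<Prod>a\<in>Z. (1 - z * cnj a) ^ order a p)"
      unfolding prod.distrib[symmetric] by (intro prod.cong refl fac)
    also have "(\<Prod>a\<in>Z. (1 - z * cnj a) ^ order a p) = (\<Prod>a\<in>Z. (1 - z * cnj a) powr of_real (real (order a p)))"
    proof (intro prod.cong refl)
      fix a assume "a \<in> Z"
      then have "Re (1 - z * cnj a) > 0"
        using z by (intro Re_one_minus_mult_cnj_pos) (auto simp: Z_def)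
      then have "1 - z * cnj a \<noteq> 0" by (metis less_irrefl zero_complex.simps(1))
      then show "(1 - z * cnj a) ^ order a p = (1 - z * cnj a) powr of_real (real (order a p))"
        by (simp add: powr_nat')
    qed
    finally show "poly p z = g z * (\<Prod>a\<in>Z. (1 - z * cnj a) powr of_real (real (order a p)))"
      by (simp add: g_def mult_ac)
  qed (use Z in \<open>auto simp: Z_def\<close>)
qed

theorem corollary3:
  shows "(\<forall>(g :: complex \<Rightarrow> complex) (n :: nat) (w :: nat \<Rightarrow> complex) (\<beta> :: nat \<Rightarrow> real)
            (c :: real) (f :: complex \<Rightarrow> complex).
            g holomorphic_on ball 0 1 \<longrightarrow>
            continuous_on (cball 0 1) g \<longrightarrow>
            (\<forall>z\<in>sphere 0 1. g z \<noteq> 0) \<longrightarrow>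
            (\<forall>i\<in>{1..n}. w i \<in> sphere 0 1) \<longrightarrow>
            inj_on w {1..n} \<longrightarrow>
            (\<forall>i\<in>{1..n}. \<beta> i > -2) \<longrightarrow>
            c > 0 \<longrightarrow>
            f = (\<lambda>z. of_real c * g z * (\<Prod>i=1..n. (1 - z * cnj (w i)) powr of_real (\<beta> i))) \<longrightarrow>
            bergman1_norm f = 1 \<longrightarrow>
            (strongly_exposed_bergman1 f \<longleftrightarrow>
               (\<forall>i\<in>{1..n}. strongly_exposed_bergman1 (f_power (\<beta> i)))) \<and>
            ((\<forall>i\<in>{1..n}. \<beta> i > -1) \<longrightarrow> strongly_exposed_bergman1 f)) \<and>
         (\<forall>p :: complex poly. bergman1_norm (poly p) = 1 \<longrightarrow> strongly_exposed_bergman1 (poly p))"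
proof -
  have "strongly_exposed_bergman1 f"
    if g: "g holomorphic_on ball 0 1" "continuous_on (cball 0 1) g" "\<forall>z\<in>sphere 0 1. g z \<noteq> 0"
      and w: "\<forall>i\<in>{1..n}. w i \<in> sphere 0 1" "inj_on w {1..n}" and \<beta>: "\<forall>i\<in>{1..n}. \<beta> i > -2" and c: "c > 0"
      and f: "f = (\<lambda>z. of_real c * g z * (\<Prod>i=1..n. (1 - z * cnj (w i)) powr of_real (\<beta> i)))" "bergman1_norm f = 1"
    for g f :: "complex \<Rightarrow> complex" and n :: nat and w :: "nat \<Rightarrow> complex" and \<beta> :: "nat \<Rightarrow> real" and c :: real
  \<comment> \<open>The general result indexes exponents by points of the circle; as
    \<open>w\<close> is injective, its inverse carries each \<beta> i over to the point
    \<open>w i\<close>. The constant \<open>c\<close> is absorbed into \<open>g\<close>.\<close>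
  proof (rule strongly_exposed_normalized_power_product[where g = "\<lambda>z. of_real c * g z" and Z = "w ` {1..n}"
        and \<beta> = "\<beta> \<circ> the_inv_into {1..n} w", OF f(2)])
    show "f z = of_real c * g z * (\<Prod>a\<in>w ` {1..n}. (1 - z * cnj a) powr of_real ((\<beta> \<circ> the_inv_into {1..n} w) a))" for z
      unfolding f(1) by (subst prod.reindex[OF w(2)], intro arg_cong2[where f = "(*)"] prod.cong refl)
        (simp add: the_inv_into_f_f[OF w(2)] del: One_nat_def)
    show "(\<beta> \<circ> the_inv_into {1..n} w) a > -2" if "a \<in> w ` {1..n}" for a
      using that \<beta> by (auto simp: the_inv_into_f_f[OF w(2)] simp del: One_nat_def)
  qed (use g w c in \<open>auto intro!: holomorphic_intros continuous_intros\<close>)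
  then show ?thesis using strongly_exposed_f_power strongly_exposed_poly by blast
qed

end
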